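(* An ordered vector space $X$ is a finite-dimensional vector lattice if and only if it is isomorphic (as an ordered vector space) to $\mathrm{Lex}(S)$ for some finite forest $S$.
   Context: All vector spaces are real. An ordered vector space is a vector space with a partial order compatible with addition and with multiplication by nonnegative scalars; equivalently it is a vector space $X$ with a cone $X_+$ (a convex set $C$ with $C+C\subset C$, $\lambda C\subset C$ for $\lambda\ge 0$, and $C\cap -C=\{0\}$), where $x \le y$ iff $y-x\in X_+$. An isomorphism of ordered vector spaces is a linear bijection that maps the positive cone onto the positive cone. A vector lattice is an ordered vector space in which every two elements have a supremum. For a poset (partially ordered set) $S$, let $F_0(S)$ be the vector space of finitely supported functions $f\colon S \to \mathbb{R}$. $\mathrm{Lex}(S)$ denotes $F_0(S)$ equipped with the cone $$\mathrm{Lex}(S)_+ = \{f \in F_0(S) \colon \text{for every } s \in S,\ f(s) < 0 \text{ implies that there exists } t<s \text{ with } f(t) > 0\}.$$ A poset $S$ is called a forest if for each $s \in S$ the set $\{t \in S \colon t < s\}$ is totally ordered. *)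

theory Defs
  imports "HOL-Analysis.Finite_Function_Topology" "HOL-Library.Lub_Glb"
begin

text \<open>
  Ordered vector spaces are types of class \<^class>\<open>ordered_real_vector\<close>.  A poset is a carrier set
  \<open>S\<close> with a relation \<open>r\<close> such that \<^term>\<open>partial_order_on S r\<close>; here \<open>(t, s) \<in> r\<close> means
  \<open>t \<le> s\<close>.
\<close>

definition finite_dimensional :: "'a::real_vector itself \<Rightarrow> bool" where
  "finite_dimensional _ \<longleftrightarrow>
     (\<exists>B. finite_dimensional_vector_space (scaleR :: real \<Rightarrow> 'a \<Rightarrow> 'a) B)"

definition vector_lattice :: "'a::ordered_real_vector itself \<Rightarrow> bool" where
  "vector_lattice _ \<longleftrightarrow> (\<forall>x y :: 'a. \<exists>z. isLub UNIV {x, y} z)"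

definition forest :: "'s set \<Rightarrow> 's rel \<Rightarrow> bool" where
  "forest S r \<longleftrightarrow>
     partial_order_on S r \<and> (\<forall>s\<in>S. total_on {t \<in> S. (t, s) \<in> r \<and> t \<noteq> s} r)"

text \<open>
  A finitely supported function on \<open>S\<close> is represented by its extension by zero to the ambient
  type, so \<open>F0 S\<close> is a subspace of \<^typ>\<open>'s \<Rightarrow>\<^sub>0 real\<close>.  The order that
  \<^theory>\<open>HOL-Library.Poly_Mapping\<close> provides on that type is not used.
\<close>

definition F0 :: "'s set \<Rightarrow> ('s \<Rightarrow>\<^sub>0 real) set" where
  "F0 S = {f. Poly_Mapping.keys f \<subseteq> S}"

definition Lex_cone :: "'s set \<Rightarrow> 's rel \<Rightarrow> ('s \<Rightarrow>\<^sub>0 real) set" where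
  "Lex_cone S r =
     {f \<in> F0 S. \<forall>s\<in>S. Poly_Mapping.lookup f s < 0 \<longrightarrow>
        (\<exists>t\<in>S. (t, s) \<in> r \<and> t \<noteq> s \<and> Poly_Mapping.lookup f t > 0)}"

definition ordered_iso ::
    "('a::ordered_real_vector \<Rightarrow> 'b::real_vector) \<Rightarrow> 'b set \<Rightarrow> 'b set \<Rightarrow> bool" where
  "ordered_iso T V C \<longleftrightarrow> linear T \<and> bij_betw T UNIV V \<and> T ` {x. 0 \<le> x} = C"

definition isomorphic_Lex ::
    "'a::ordered_real_vector itself \<Rightarrow> 's set \<Rightarrow> 's rel \<Rightarrow> bool" where
  "isomorphic_Lex _ S r \<longleftrightarrow>
     (\<exists>T :: 'a \<Rightarrow> ('s \<Rightarrow>\<^sub>0 real). ordered_iso T (F0 S) (Lex_cone S r))"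

text \<open>The following facts confirm that \<open>Lex_cone S r\<close> makes \<open>F0 S\<close> an ordered vector space.\<close>

lemma lookup_scaleR:
  "Poly_Mapping.lookup (c *\<^sub>R f) s = c *\<^sub>R Poly_Mapping.lookup f s"
proof -
  have "finite {i. c *\<^sub>R Poly_Mapping.lookup f i \<noteq> 0}"
    by (rule finite_subset[OF _ finite_lookup[of f]]) auto
  then show ?thesis
    by (simp add: scaleR_poly_mapping_def)
qed

lemma subspace_F0: "subspace (F0 S)"
  unfolding subspace_def F0_def
  by (auto simp: in_keys_iff lookup_add lookup_scaleR subset_iff) (metis add.right_neutral)

lemma Lex_cone_pos_below:
  assumes "partial_order_on S r" "f \<in> Lex_cone S r" "g \<in> Lex_cone S r"
    and s: "s \<in> S" "Poly_Mapping.lookup f s < 0"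
  obtains t where "t \<in> S" "(t, s) \<in> r" "t \<noteq> s"
    "Poly_Mapping.lookup f t \<ge> 0" "Poly_Mapping.lookup g t \<ge> 0"
    "Poly_Mapping.lookup f t > 0 \<or> Poly_Mapping.lookup g t > 0"
proof -
  note po = partial_order_onD[OF assms(1)]
  define A where "A = {t \<in> S. (t, s) \<in> r \<and> t \<noteq> s \<and> (t \<in> Poly_Mapping.keys f \<union> Poly_Mapping.keys g)}"
  define q where "q = (r - Id) \<inter> A \<times> A"
  have fin: "finite A"
    unfolding A_def by (rule finite_subset[of _ "Poly_Mapping.keys f \<union> Poly_Mapping.keys g"]) auto
  have "acyclic q"
    using partial_order_on_acyclic[OF assms(1)] by (rule acyclic_subset) (auto simp: q_def)
  moreover have "finite q"
    unfolding q_def using fin by auto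
  ultimately have "wf q"
    by (simp add: finite_acyclic_wf)
  have "\<exists>t. t \<in> A"
    using assms(2) s unfolding Lex_cone_def A_def by (fastforce simp: in_keys_iff)
  then obtain t where t: "t \<in> A" and min: "\<And>u. (u, t) \<in> q \<Longrightarrow> u \<notin> A"
    using \<open>wf q\<close> by (meson wfE_min)
  have none: "u \<notin> Poly_Mapping.keys f \<union> Poly_Mapping.keys g" if "u \<in> S" "(u, t) \<in> r" "u \<noteq> t" for u
  proof
    assume "u \<in> Poly_Mapping.keys f \<union> Poly_Mapping.keys g"
    moreover have "(t, s) \<in> r" "t \<noteq> s"
      using t by (auto simp: A_def)
    then have "(u, s) \<in> r" "u \<noteq> s"
      using that po(2,3) by (auto dest: transD antisymD)
    ultimately have "u \<in> A"
      using that by (auto simp: A_def)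
    with min that t show False
      by (auto simp: q_def)
  qed
  have ge: "Poly_Mapping.lookup h t \<ge> 0" if h: "h \<in> Lex_cone S r" "h = f \<or> h = g" for h
  proof (rule ccontr)
    assume "\<not> ?thesis"
    then obtain u where "u \<in> S" "(u, t) \<in> r" "u \<noteq> t" "Poly_Mapping.lookup h u > 0"
      using h(1) t unfolding Lex_cone_def A_def by (auto simp: not_le)
    with none h(2) show False
      by (auto simp: in_keys_iff)
  qed
  have "Poly_Mapping.lookup f t \<ge> 0" "Poly_Mapping.lookup g t \<ge> 0"
    using ge assms(2,3) by auto
  with t that show thesis
    unfolding A_def by (fastforce simp: in_keys_iff)
qed

lemma Lex_cone_add:
  assumes "partial_order_on S r" "f \<in> Lex_cone S r" "g \<in> Lex_cone S r"
  shows "f + g \<in> Lex_cone S r"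
proof -
  have "f + g \<in> F0 S"
    using assms subspace_add[OF subspace_F0] by (auto simp: Lex_cone_def)
  moreover have "\<exists>t\<in>S. (t, s) \<in> r \<and> t \<noteq> s \<and> Poly_Mapping.lookup (f + g) t > 0"
    if "s \<in> S" and neg: "Poly_Mapping.lookup (f + g) s < 0" for s
  proof -
    have "Poly_Mapping.lookup f s < 0 \<or> Poly_Mapping.lookup g s < 0"
      using neg by (auto simp: lookup_add)
    then show ?thesis
    proof
      assume "Poly_Mapping.lookup f s < 0"
      with assms \<open>s \<in> S\<close> show ?thesis
        by (elim Lex_cone_pos_below[of S r f g s]) (force simp: lookup_add)+
    next
      assume "Poly_Mapping.lookup g s < 0"
      with assms \<open>s \<in> S\<close> show ?thesis
        by (elim Lex_cone_pos_below[of S r g f s]) (force simp: lookup_add)+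
    qed
  qed
  ultimately show ?thesis
    by (auto simp: Lex_cone_def)
qed

lemma Lex_cone_scaleR:
  assumes "f \<in> Lex_cone S r" "0 \<le> c"
  shows "c *\<^sub>R f \<in> Lex_cone S r"
proof (cases "c = 0")
  case True
  then show ?thesis
    by (auto simp: Lex_cone_def F0_def)
next
  case False
  with assms show ?thesis
    using subspace_scale[OF subspace_F0, of f S c]
    by (auto simp: Lex_cone_def lookup_scaleR mult_less_0_iff zero_less_mult_iff)
qed

lemma Lex_cone_pointed:
  assumes "partial_order_on S r" "f \<in> Lex_cone S r" "- f \<in> Lex_cone S r"
  shows "f = 0"
proof -
  have "Poly_Mapping.lookup f s = 0" for s
  proof (rule ccontr)
    assume nz: "Poly_Mapping.lookup f s \<noteq> 0"
    then have s: "s \<in> S"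
      using assms(2) by (auto simp: Lex_cone_def F0_def in_keys_iff)
    consider "Poly_Mapping.lookup f s < 0" | "Poly_Mapping.lookup (- f) s < 0"
      using nz by fastforce
    then show False
    proof cases
      case 1
      from Lex_cone_pos_below[OF assms s 1] show False
        by (metis lookup_uminus neg_0_le_iff_le order_le_less_trans less_irrefl neg_0_less_iff_less)
    next
      case 2
      from Lex_cone_pos_below[OF assms(1,3,2) s 2] show False
        by (metis lookup_uminus neg_0_le_iff_le order_le_less_trans less_irrefl neg_0_less_iff_less)
    qed
  qed
  then show ?thesis
    by (intro poly_mapping_eqI) auto
qed

end

theory Submission
  imports Defs
begin

text \<open>
  In \<open>Lex(S)\<close> an element is positive iff it is positive at every minimal point of its support, and
  over a forest this gives an explicit positive part, so \<open>Lex(S)\<close> is a lattice.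

  Conversely, let \<open>u\<close> be an order unit of an ideal \<open>J\<close> of a finite-dimensional vector lattice.
  If \<open>J\<close> contains nonzero disjoint \<open>a, b \<ge> 0\<close> such that \<open>a + b\<close> is also an order unit, then \<open>J\<close> is the
  direct sum of the ideals generated by \<open>a\<close> and \<open>b\<close>.  Otherwise the elements that do not dominate
  a positive multiple of \<open>u\<close> form an ideal \<open>M\<close> with \<open>J = \<real>u \<oplus> M\<close> and \<open>M \<le> u\<close>, so \<open>J\<close> is the
  lexicographic product of \<open>\<real>\<close> and \<open>M\<close>.  By induction on the dimension, \<open>J\<close> has a basis that
  carries a forest order and identifies \<open>J\<close> with \<open>Lex(S)\<close>: in the first case the two forests are
  put side by side, in the second one \<open>u\<close> becomes a new root below the forest of \<open>M\<close>.
  Finite dimension enters in showing that \<open>M\<close> is closed under addition: for \<open>x, y \<ge> 0\<close> some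
  \<open>\<bar>x - t y\<bar>\<close> with \<open>t > 0\<close> dominates a multiple of \<open>x + y\<close>.
\<close>

section \<open>\<open>Lex(S)\<close> over a forest: minimal support points and positive
  parts\<close>

text \<open>The cone condition for arbitrary real-valued functions, so that it also applies to
  coefficient families indexed by basis vectors.\<close>

definition lex_nonneg :: "'s set \<Rightarrow> 's rel \<Rightarrow> ('s \<Rightarrow> real) \<Rightarrow> bool" where
  "lex_nonneg S r f \<longleftrightarrow> (\<forall>s\<in>S. f s < 0 \<longrightarrow> (\<exists>t\<in>S. (t, s) \<in> r \<and> t \<noteq> s \<and> 0 < f t))"

lemma Lex_cone_iff: "f \<in> Lex_cone S r \<longleftrightarrow> f \<in> F0 S \<and> lex_nonneg S r (Poly_Mapping.lookup f)"
  by (auto simp: Lex_cone_def lex_nonneg_def)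

text \<open>A negative value at a minimal support point has nothing below to compensate it.
  Conversely, finiteness puts a minimal support point below each negative one, and its positive
  value is the required witness.\<close>

lemma lex_nonneg_iff_minimal:
  assumes po: "partial_order_on S r" and fin: "finite {s \<in> S. f s \<noteq> 0}"
  shows "lex_nonneg S r f \<longleftrightarrow>
    (\<forall>s\<in>S. f s \<noteq> 0 \<longrightarrow> (\<forall>t\<in>S. (t, s) \<in> r \<longrightarrow> t \<noteq> s \<longrightarrow> f t = 0) \<longrightarrow> 0 < f s)"
    (is "_ = ?M")
proof
  assume ?M
  show "lex_nonneg S r f"
    unfolding lex_nonneg_def
  proof (intro ballI impI)
    fix s assume s: "s \<in> S" "f s < 0"
    define A where "A = {t \<in> S. f t \<noteq> 0 \<and> (t, s) \<in> r}"
    have "s \<in> A"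
      using s partial_order_onD(1)[OF po] by (auto simp: A_def refl_on_def)
    moreover have "finite A"
      by (rule finite_subset[OF _ fin]) (auto simp: A_def)
    moreover have "asymp_on A (\<lambda>t u. (t, u) \<in> r \<and> t \<noteq> u)"
      using partial_order_onD(3)[OF po] by (auto simp: asymp_on_def dest: antisymD)
    moreover have "transp_on A (\<lambda>t u. (t, u) \<in> r \<and> t \<noteq> u)"
      using partial_order_onD(2,3)[OF po]
      by (auto simp: transp_on_def dest: transD antisymD)
    ultimately obtain m where m: "m \<in> A" "\<And>t. t \<in> A \<Longrightarrow> t \<noteq> m \<Longrightarrow> (t, m) \<notin> r"
      using Finite_Set.bex_min_element[of A "\<lambda>t u. (t, u) \<in> r \<and> t \<noteq> u"] by blast
    have "f t = 0" if "t \<in> S" "(t, m) \<in> r" "t \<noteq> m" for t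
      using m that partial_order_onD(2)[OF po] by (auto simp: A_def dest: transD)
    with \<open>?M\<close> m(1) have "0 < f m"
      by (auto simp: A_def)
    with m(1) s show "\<exists>t\<in>S. (t, s) \<in> r \<and> t \<noteq> s \<and> 0 < f t"
      by (intro bexI[of _ m]) (auto simp: A_def)
  qed
next
  assume "lex_nonneg S r f"
  then show ?M
    unfolding lex_nonneg_def by (metis less_irrefl linorder_neqE_linordered_idom)
qed

lemma Lex_cone_iff_minimal:
  assumes "partial_order_on S r" "f \<in> F0 S"
  shows "f \<in> Lex_cone S r \<longleftrightarrow>
    (\<forall>s\<in>S. Poly_Mapping.lookup f s \<noteq> 0 \<longrightarrow>
       (\<forall>t\<in>S. (t, s) \<in> r \<longrightarrow> t \<noteq> s \<longrightarrow> Poly_Mapping.lookup f t = 0) \<longrightarrow> 0 < Poly_Mapping.lookup f s)"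
proof -
  have "finite {s \<in> S. Poly_Mapping.lookup f s \<noteq> 0}"
    by (rule finite_subset[OF _ finite_lookup[of f]]) auto
  from lex_nonneg_iff_minimal[OF assms(1) this] assms(2) show ?thesis
    by (simp add: Lex_cone_iff)
qed

text \<open>
  In a forest there is at most one minimal point of the support of \<open>f\<close> below a given point;
  the positive part of \<open>f\<close> keeps the values of \<open>f\<close> above those minimal points at which \<open>f\<close>
  is positive.
\<close>

lemma Lex_cone_positive_part:
  assumes S: "forest S r" and f: "f \<in> F0 S"
  obtains g where "g \<in> Lex_cone S r" "g - f \<in> Lex_cone S r"
    "\<And>h. h \<in> Lex_cone S r \<Longrightarrow> h - f \<in> Lex_cone S r \<Longrightarrow> h - g \<in> Lex_cone S r"
proof -
  have po: "partial_order_on S r"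
    using S by (simp add: forest_def)
  have refl: "(s, s) \<in> r" if "s \<in> S" for s
    using partial_order_onD(1)[OF po] that by (auto simp: refl_on_def)
  have trans: "(s, u) \<in> r" if "(s, t) \<in> r" "(t, u) \<in> r" for s t u
    using partial_order_onD(2)[OF po] that by (rule transD)
  have antisym: "s = t" if "(s, t) \<in> r" "(t, s) \<in> r" for s t
    using partial_order_onD(3)[OF po] that by (rule antisymD)
  have chain: "(t, u) \<in> r \<or> (u, t) \<in> r" if "t \<in> S" "u \<in> S" "s \<in> S" "(t, s) \<in> r" "(u, s) \<in> r" for s t u
    using S that refl unfolding forest_def total_on_def by (cases "t = s \<or> u = s \<or> t = u") auto
  let ?l = Poly_Mapping.lookup
  \<comment> \<open>The region above the positive minimal support points of \<open>f\<close>; it is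
    closed upwards (\<open>P_up\<close>).\<close>
  define P where "P s \<longleftrightarrow> (\<exists>m\<in>S. (m, s) \<in> r \<and> 0 < ?l f m \<and>
    (\<forall>t\<in>S. (t, m) \<in> r \<longrightarrow> t \<noteq> m \<longrightarrow> ?l f t = 0))" for s
  define g where "g = Poly_Mapping.Abs_poly_mapping (\<lambda>s. if P s then ?l f s else 0)"
  have g: "?l g s = (if P s then ?l f s else 0)" for s
  proof -
    have "finite {s. (if P s then ?l f s else 0) \<noteq> 0}"
      by (rule finite_subset[OF _ finite_lookup[of f]]) auto
    then show ?thesis
      by (simp add: g_def)
  qed
  have gF: "g \<in> F0 S"
    using f by (auto simp: F0_def in_keys_iff g subset_iff split: if_splits)
  have P_up: "P s" if "P t" "(t, s) \<in> r" for s t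
    using that trans unfolding P_def by blast
  note diffF = subspace_diff[OF subspace_F0]
  show thesis
  proof
    show "g \<in> Lex_cone S r"
      unfolding Lex_cone_iff_minimal[OF po gF]
    proof (intro ballI impI)
      fix s assume s: "s \<in> S" "?l g s \<noteq> 0"
        and min: "\<forall>t\<in>S. (t, s) \<in> r \<longrightarrow> t \<noteq> s \<longrightarrow> ?l g t = 0"
      then obtain m where m: "m \<in> S" "(m, s) \<in> r" "0 < ?l f m"
        "\<forall>t\<in>S. (t, m) \<in> r \<longrightarrow> t \<noteq> m \<longrightarrow> ?l f t = 0"
        by (auto simp: g P_def split: if_splits)
      then have "P m"
        using refl unfolding P_def by blast
      with m min s have "m = s"
        by (auto simp: g)
      with m \<open>P m\<close> show "0 < ?l g s"
        by (simp add: g)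
    qed
    show "g - f \<in> Lex_cone S r"
      unfolding Lex_cone_iff_minimal[OF po diffF[OF gF f]]
    proof (intro ballI impI)
      fix s assume s: "s \<in> S" "?l (g - f) s \<noteq> 0"
        and min: "\<forall>t\<in>S. (t, s) \<in> r \<longrightarrow> t \<noteq> s \<longrightarrow> ?l (g - f) t = 0"
      then have nP: "\<not> P s" "?l f s \<noteq> 0"
        by (auto simp: lookup_minus g split: if_splits)
      \<comment> \<open>Since \<open>P\<close> is closed upwards, it fails everywhere below
        \<open>s\<close>, so \<open>g - f\<close> equals \<open>- f\<close> there and
        \<open>s\<close> is also minimal in the support of \<open>f\<close>.\<close>
      then have "?l f t = 0" if "t \<in> S" "(t, s) \<in> r" "t \<noteq> s" for t
        using min that P_up[of t s] by (auto simp: lookup_minus g split: if_splits)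
      with nP s(1) refl have "\<not> 0 < ?l f s"
        unfolding P_def by blast
      with nP show "0 < ?l (g - f) s"
        by (simp add: lookup_minus g)
    qed
    fix h assume h: "h \<in> Lex_cone S r" and hf: "h - f \<in> Lex_cone S r"
    then have hF: "h \<in> F0 S"
      by (simp add: Lex_cone_iff)
    show "h - g \<in> Lex_cone S r"
      unfolding Lex_cone_iff_minimal[OF po diffF[OF hF gF]]
    proof (intro ballI impI)
      fix s assume s: "s \<in> S" "?l (h - g) s \<noteq> 0"
        and min: "\<forall>t\<in>S. (t, s) \<in> r \<longrightarrow> t \<noteq> s \<longrightarrow> ?l (h - g) t = 0"
      show "0 < ?l (h - g) s"
      \<comment> \<open>At \<open>s\<close> and below it, \<open>h - g\<close> coincides with
        \<open>h - f\<close> if \<open>P s\<close> holds and with \<open>h\<close> otherwise, so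
        positivity is inherited from one of the two.\<close>
      proof (cases "P s")
        case True
        then obtain m where m: "m \<in> S" "(m, s) \<in> r" "0 < ?l f m"
          "\<forall>t\<in>S. (t, m) \<in> r \<longrightarrow> t \<noteq> m \<longrightarrow> ?l f t = 0"
          by (auto simp: P_def)
        have "?l g t = ?l f t" if t: "t \<in> S" "(t, s) \<in> r" for t
        proof (cases "(m, t) \<in> r")
          case True
          with m have "P t"
            unfolding P_def by blast
          then show ?thesis
            by (simp add: g)
        next
          \<comment> \<open>Here the forest property enters: \<open>t\<close> and \<open>m\<close>
            both lie below \<open>s\<close>, hence are comparable, so \<open>t\<close> is strictly
            below \<open>m\<close>, where \<open>f\<close> vanishes.\<close>
          case False
          with chain[OF t(1) m(1) s(1) t(2) m(2)] refl m t have "?l f t = 0"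
            by blast
          then show ?thesis
            by (simp add: g)
        qed
        with hf min s show ?thesis
          unfolding Lex_cone_iff_minimal[OF po diffF[OF hF f]] by (auto simp: lookup_minus refl)
      next
        case False
        then have "?l g t = 0" if "(t, s) \<in> r" for t
          using that P_up by (auto simp: g)
        with h min s show ?thesis
          unfolding Lex_cone_iff_minimal[OF po hF] by (auto simp: lookup_minus refl)
      qed
    qed
  qed
qed

section \<open>Finite dimension, and the lattice property of spaces isomorphic to
  \<open>Lex(S)\<close>\<close>

lemma span_single_F0:
  assumes "finite S"
  shows "F0 S \<subseteq> span ((\<lambda>s. Poly_Mapping.single s (1::real)) ` S)"
proof
  fix f :: "'a \<Rightarrow>\<^sub>0 real" assume "f \<in> F0 S"
  then have "Poly_Mapping.lookup f k = (\<Sum>s\<in>S. if s = k then Poly_Mapping.lookup f s else 0)" for k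
    using assms by (auto simp: F0_def in_keys_iff)
  then have "f = (\<Sum>s\<in>S. Poly_Mapping.lookup f s *\<^sub>R Poly_Mapping.single s 1)"
    by (intro poly_mapping_eqI)
      (auto simp: lookup_sum lookup_scaleR lookup_single when_def intro!: sum.cong)
  also have "\<dots> \<in> span ((\<lambda>s. Poly_Mapping.single s 1) ` S)"
    by (intro span_sum span_scale span_base) auto
  finally show "f \<in> span ((\<lambda>s. Poly_Mapping.single s 1) ` S)" .
qed

text \<open>A maximal independent subset of a finite spanning set supplies the basis that the locale
  demands.\<close>

lemma finite_dimensional_iff_finite_span:
  "finite_dimensional TYPE('a::real_vector) \<longleftrightarrow> (\<exists>B :: 'a set. finite B \<and> span B = UNIV)"
proof
  assume "finite_dimensional TYPE('a)"
  then obtain B where "finite_dimensional_vector_space (scaleR :: real \<Rightarrow> 'a \<Rightarrow> 'a) B"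
    by (auto simp: finite_dimensional_def)
  then have "finite B \<and> span B = UNIV"
    by (simp add: finite_dimensional_vector_space_def finite_dimensional_vector_space_axioms_def
        span_raw_def)
  then show "\<exists>B :: 'a set. finite B \<and> span B = UNIV" ..
next
  assume "\<exists>B :: 'a set. finite B \<and> span B = UNIV"
  then obtain B :: "'a set" where B: "finite B" "span B = UNIV"
    by blast
  obtain C where C: "C \<subseteq> B" "independent C" "B \<subseteq> span C"
    using maximal_independent_subset by blast
  then have "span C = UNIV"
    using B(2) span_minimal[OF C(3)] by auto
  with C B(1) have "finite_dimensional_vector_space (scaleR :: real \<Rightarrow> 'a \<Rightarrow> 'a) C"
    by unfold_locales
      (auto simp: span_raw_def dependent_raw_def intro: finite_subset)
  then show "finite_dimensional TYPE('a)"
    by (auto simp: finite_dimensional_def)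
qed

lemma isLub_pair_iff:
  "isLub UNIV {x, y} z \<longleftrightarrow> x \<le> z \<and> y \<le> z \<and> (\<forall>w. x \<le> w \<longrightarrow> y \<le> w \<longrightarrow> z \<le> w)"
  by (auto simp: isLub_def leastP_def isUb_def setle_def setge_def)

text \<open>The preimages of the point masses on \<open>S\<close> form a finite spanning
  set.\<close>

lemma isomorphic_Lex_finite_dimensional:
  assumes "isomorphic_Lex TYPE('a::ordered_real_vector) S r" "finite S"
  shows "finite_dimensional TYPE('a)"
proof -
  obtain T :: "'a \<Rightarrow> _" where T: "linear T" "bij_betw T UNIV (F0 S)"
    using assms(1) by (auto simp: isomorphic_Lex_def ordered_iso_def)
  define E where "E = (\<lambda>s. Poly_Mapping.single s (1::real)) ` S"
  have E: "E \<subseteq> F0 S"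
    by (auto simp: E_def F0_def)
  define B where "B = inv T ` E"
  have TB: "T ` B = E"
    using E T(2) by (force simp: B_def bij_betw_def image_comp f_inv_into_f)
  have "x \<in> span B" for x
  proof -
    have "T x \<in> span E"
      using T(2) span_single_F0[OF assms(2)] by (auto simp: E_def bij_betw_def)
    also have "span E = T ` span B"
      using linear_span_image[OF T(1), of B] TB by simp
    finally show ?thesis
      using T(2) by (auto simp: bij_betw_def inj_on_def)
  qed
  moreover have "finite B"
    using assms(2) by (simp add: B_def E_def)
  ultimately show ?thesis
    unfolding finite_dimensional_iff_finite_span by blast
qed

text \<open>The supremum of \<open>x\<close> and \<open>y\<close> is \<open>y\<close> plus the
  positive part of \<open>x - y\<close>; the latter is computed in \<open>Lex(S)\<close> and pulled
  back along \<open>T\<close>.\<close>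

lemma isomorphic_Lex_vector_lattice:
  assumes "isomorphic_Lex TYPE('a::ordered_real_vector) S r" "forest S r"
  shows "vector_lattice TYPE('a)"
proof -
  obtain T :: "'a \<Rightarrow> _" where T: "linear T" "bij_betw T UNIV (F0 S)" "T ` {x. 0 \<le> x} = Lex_cone S r"
    using assms(1) by (auto simp: isomorphic_Lex_def ordered_iso_def)
  have inj: "inj T" and ran: "range T = F0 S"
    using T(2) by (auto simp: bij_betw_def)
  have pos: "0 \<le> x \<longleftrightarrow> T x \<in> Lex_cone S r" for x
    using T(3) inj by (auto simp: inj_on_def)
  have le: "x \<le> y \<longleftrightarrow> T y - T x \<in> Lex_cone S r" for x y
    using pos[of "y - x"] by (simp add: linear_diff[OF T(1)])
  have "\<exists>z. isLub UNIV {x, y} z" for x y :: 'a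
  proof -
    have "T x - T y \<in> F0 S"
      using ran by (intro subspace_diff[OF subspace_F0]) auto
    from Lex_cone_positive_part[OF assms(2) this]
    obtain g where g: "g \<in> Lex_cone S r" "g - (T x - T y) \<in> Lex_cone S r"
      "\<And>h. h \<in> Lex_cone S r \<Longrightarrow> h - (T x - T y) \<in> Lex_cone S r \<Longrightarrow> h - g \<in> Lex_cone S r"
      by blast
    then obtain w where w: "g = T w"
      using ran by (auto simp: Lex_cone_iff)
    have "isLub UNIV {x, y} (y + w)"
      unfolding isLub_pair_iff le linear_add[OF T(1)]
      using g(1,2) g(3)[of "T z - T y" for z]
      by (auto simp: w algebra_simps)
    then show ?thesis ..
  qed
  then show ?thesis
    by (simp add: vector_lattice_def)
qed

section \<open>Modulus and ideals of a vector lattice\<close>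

text \<open>For \<open>a, b \<ge> 0\<close>, the vectors \<open>a\<close> and \<open>b\<close> have infimum \<open>0\<close>.\<close>

definition lat_disj :: "'a::ordered_real_vector \<Rightarrow> 'a \<Rightarrow> bool" where
  "lat_disj a b \<longleftrightarrow> (\<forall>z. z \<le> a \<longrightarrow> z \<le> b \<longrightarrow> z \<le> 0)"

lemma lat_disjD: "lat_disj a b \<Longrightarrow> z \<le> a \<Longrightarrow> z \<le> b \<Longrightarrow> z \<le> 0"
  by (simp add: lat_disj_def)

lemma lat_disj_commute: "lat_disj a b \<longleftrightarrow> lat_disj b a"
  by (auto simp: lat_disj_def)

lemma lat_disj_mono: "lat_disj a b \<Longrightarrow> a' \<le> a \<Longrightarrow> b' \<le> b \<Longrightarrow> lat_disj a' b'"
  unfolding lat_disj_def using order_trans by blast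

lemma lat_disj_scaleR:
  fixes a b :: "'a::ordered_real_vector"
  assumes "lat_disj a b" "0 \<le> a" "0 \<le> b"
  shows "lat_disj (c *\<^sub>R a) (d *\<^sub>R b)"
  unfolding lat_disj_def
proof (intro allI impI)
  fix z assume z: "z \<le> c *\<^sub>R a" "z \<le> d *\<^sub>R b"
  \<comment> \<open>The entry \<open>1\<close> keeps \<open>k\<close> positive whatever the signs of
    \<open>c\<close> and \<open>d\<close>, so that a common lower bound may be divided by
    it.\<close>
  define k where "k = max 1 (max c d)"
  have k: "0 < k" "c \<le> k" "d \<le> k"
    by (auto simp: k_def)
  have "z \<le> k *\<^sub>R a" "z \<le> k *\<^sub>R b"
    using z k assms(2,3) by (auto intro: order_trans scaleR_right_mono)
  then have "z /\<^sub>R k \<le> a" "z /\<^sub>R k \<le> b"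
    using k(1) by (simp_all add: pos_divideR_le_eq)
  with assms(1) have "z /\<^sub>R k \<le> 0"
    by (rule lat_disjD)
  then show "z \<le> 0"
    using k(1) by (simp add: pos_divideR_le_eq)
qed

text \<open>For a common lower bound \<open>z\<close>, disjointness from \<open>c\<close> applied to
  \<open>z - b\<close> gives \<open>z \<le> b\<close>; then disjointness from \<open>b\<close>
  applies to \<open>z\<close> itself.\<close>

lemma lat_disj_add:
  fixes a b c :: "'a::ordered_real_vector"
  assumes "lat_disj a b" "lat_disj a c" "0 \<le> b"
  shows "lat_disj a (b + c)"
  unfolding lat_disj_def
proof (intro allI impI)
  fix z assume z: "z \<le> a" "z \<le> b + c"
  have "z - b \<le> a"
    using z(1) assms(3) by (metis add_increasing2 diff_le_eq)
  moreover have "z - b \<le> c"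
    using z(2) by (simp add: algebra_simps)
  ultimately have "z - b \<le> 0"
    by (rule lat_disjD[OF assms(2)])
  with z(1) show "z \<le> 0"
    using lat_disjD[OF assms(1)] by simp
qed

lemma lat_disj_sum:
  fixes a :: "'a::ordered_real_vector"
  assumes "\<And>i. i \<in> I \<Longrightarrow> lat_disj a (b i)" "\<And>i. i \<in> I \<Longrightarrow> 0 \<le> b i" "0 \<le> a"
  shows "lat_disj a (sum b I)"
  using assms
proof (induction I rule: infinite_finite_induct)
  case (insert i I)
  then show ?case
    by (auto intro: lat_disj_add)
qed (auto simp: lat_disj_def)

text \<open>The assumption says that \<open>m x\<close> is the supremum of \<open>x\<close> and
  \<open>- x\<close>, that is, the absolute value. All lattice arguments below are derived from it;
  \<open>modulus_exists\<close> provides it in a vector lattice.\<close>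

locale modulus =
  fixes m :: "'a::ordered_real_vector \<Rightarrow> 'a"
  assumes m_le_iff: "m x \<le> z \<longleftrightarrow> x \<le> z \<and> - x \<le> z"
begin

lemma m_ge: "x \<le> m x" "- x \<le> m x"
  using m_le_iff[of x "m x"] by auto

lemma m_minus [simp]: "m (- x) = m x"
  using m_ge[of x] m_ge[of "- x"] by (intro antisym) (simp_all add: m_le_iff)

lemma m_nonneg [simp]: "0 \<le> m x"
proof -
  have "x + (- x) \<le> m x + m x"
    by (intro add_mono m_ge)
  then have "0 \<le> 2 *\<^sub>R m x"
    by (simp add: scaleR_2)
  then show ?thesis
    by (simp add: zero_le_scaleR_iff)
qed

lemma m_of_nonneg: "0 \<le> x \<Longrightarrow> m x = x"
  by (rule antisym) (auto simp: m_le_iff m_ge intro: order_trans[of _ 0])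

lemma m_triangle: "m (x + y) \<le> m x + m y"
  unfolding m_le_iff minus_add_distrib by (intro conjI add_mono m_ge)

lemma m_sum_le: "m (sum f A) \<le> (\<Sum>i\<in>A. m (f i))"
proof (induction A rule: infinite_finite_induct)
  case (insert i A)
  then show ?case
    using order_trans[OF m_triangle add_left_mono] by simp
qed (simp_all add: m_of_nonneg)

lemma m_scaleR: "m (c *\<^sub>R x) = \<bar>c\<bar> *\<^sub>R m x"
proof -
  have le: "m (c *\<^sub>R x) \<le> \<bar>c\<bar> *\<^sub>R m x" for c x
  proof -
    have "\<bar>c\<bar> *\<^sub>R x \<le> \<bar>c\<bar> *\<^sub>R m x" "\<bar>c\<bar> *\<^sub>R (- x) \<le> \<bar>c\<bar> *\<^sub>R m x"
      by (intro scaleR_left_mono m_ge; simp)+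
    then show ?thesis
      unfolding m_le_iff by (cases "0 \<le> c") auto
  qed
  show ?thesis
  proof (cases "c = 0")
    case True
    then show ?thesis
      by (simp add: m_of_nonneg)
  next
    case False
    \<comment> \<open>The reverse inequality is the first one for the scalar \<open>1 / c\<close>
      and the vector \<open>c *\<^sub>R x\<close>.\<close>
    then have "m x \<le> m (c *\<^sub>R x) /\<^sub>R \<bar>c\<bar>"
      using le[of "1 / c" "c *\<^sub>R x"] by (simp add: divide_inverse)
    then have "\<bar>c\<bar> *\<^sub>R m x \<le> m (c *\<^sub>R x)"
      using False by (simp add: pos_le_divideR_eq)
    with le show ?thesis
      by (intro antisym)
  qed
qed

text \<open>The supremum of \<open>x\<close> and \<open>0\<close> in terms of the modulus;
  \<open>pos_part (- x)\<close> is the negative part.\<close>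

definition pos_part :: "'a \<Rightarrow> 'a" where
  "pos_part x = (m x + x) /\<^sub>R 2"

lemma le_pos_part_iff: "z \<le> pos_part x \<longleftrightarrow> 2 *\<^sub>R z \<le> m x + x"
  unfolding pos_part_def by (rule pos_le_divideR_eq) simp

lemma pos_part_ge: "x \<le> pos_part x"
  using m_ge[of x] by (simp add: le_pos_part_iff scaleR_2)

lemma pos_part_nonneg [simp]: "0 \<le> pos_part x"
  using add_right_mono[OF m_ge(2)[of x], of x] by (simp add: le_pos_part_iff)

lemma pos_part_of_nonneg: "0 \<le> x \<Longrightarrow> pos_part x = x"
  by (simp add: pos_part_def m_of_nonneg flip: scaleR_2)

text \<open>The claim amounts to \<open>m x \<le> m y + y - x\<close>, which the characterisation of
  \<open>m\<close> splits into two inequalities without a modulus on the left.\<close>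

lemma pos_part_mono:
  assumes "x \<le> y"
  shows "pos_part x \<le> pos_part y"
proof -
  have "m x \<le> m y + y - x"
    unfolding m_le_iff
  proof
    have "x + x \<le> y + y"
      using assms by (rule add_mono[OF _ assms])
    also have "\<dots> \<le> m y + y"
      by (simp add: m_ge)
    finally show "x \<le> m y + y - x"
      by (simp add: algebra_simps)
    show "- x \<le> m y + y - x"
      using add_right_mono[OF m_ge(2)[of y], of y] by simp
  qed
  then have "m x + x \<le> m y + y"
    by (simp add: algebra_simps)
  then show ?thesis
    unfolding pos_part_def by (intro scaleR_left_mono) auto
qed

lemma pos_part_least: "x \<le> z \<Longrightarrow> 0 \<le> z \<Longrightarrow> pos_part x \<le> z"
  using pos_part_mono[of x z] by (simp add: pos_part_of_nonneg)

lemma pos_part_le_m: "pos_part x \<le> m x"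
  by (intro pos_part_least m_ge m_nonneg)

lemma pos_part_eq_0_iff: "pos_part x = 0 \<longleftrightarrow> x \<le> 0"
  using pos_part_ge[of x] pos_part_least[of x 0] by (auto intro: antisym)

lemma pos_part_scaleR: "0 \<le> c \<Longrightarrow> pos_part (c *\<^sub>R x) = c *\<^sub>R pos_part x"
  by (simp add: pos_part_def m_scaleR algebra_simps)

lemma pos_part_plus_neg: "pos_part x + pos_part (- x) = m x"
proof -
  have "pos_part x + pos_part (- x) = (2 *\<^sub>R m x) /\<^sub>R 2"
    unfolding pos_part_def scaleR_2 by (simp flip: scaleR_add_right)
  then show ?thesis
    by simp
qed

lemma pos_part_minus_neg: "pos_part x - pos_part (- x) = x"
proof -
  have "pos_part x - pos_part (- x) = (2 *\<^sub>R x) /\<^sub>R 2"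
    unfolding pos_part_def scaleR_2 by (simp flip: scaleR_diff_right)
  then show ?thesis
    by simp
qed

text \<open>A common lower bound \<open>z\<close> makes \<open>m x - 2 *\<^sub>R z\<close> another
  upper bound of \<open>x\<close> and \<open>- x\<close>; as \<open>m x\<close> is the least one,
  \<open>z \<le> 0\<close>.\<close>

lemma lat_disj_pos_part: "lat_disj (pos_part x) (pos_part (- x))"
  unfolding lat_disj_def
proof (intro allI impI)
  fix z assume z: "z \<le> pos_part x" "z \<le> pos_part (- x)"
  have "m x \<le> m x - 2 *\<^sub>R z"
    using z unfolding m_le_iff le_pos_part_iff by (simp add: algebra_simps)
  then have "2 *\<^sub>R z \<le> 2 *\<^sub>R 0"
    by simp
  then show "z \<le> 0"
    by (subst (asm) scaleR_le_cancel_left_pos) auto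
qed

section \<open>Disjoint vectors and the bound that the dimension puts on their number\<close>

text \<open>In a vanishing linear combination the modulus of each term is dominated by the sum of
  the moduli of the others. It is disjoint from that sum, hence zero.\<close>

lemma independent_if_disj:
  fixes Z :: "'a set"
  assumes "finite Z" and pos: "\<And>z. z \<in> Z \<Longrightarrow> 0 \<le> z \<and> z \<noteq> 0"
    and dis: "\<And>y z. y \<in> Z \<Longrightarrow> z \<in> Z \<Longrightarrow> y \<noteq> z \<Longrightarrow> lat_disj y z"
  shows "independent Z"
proof (rule independent_if_scalars_zero[OF \<open>finite Z\<close>])
  fix f x assume sum: "(\<Sum>z\<in>Z. f z *\<^sub>R z) = 0" and x: "x \<in> Z"
  have "f x *\<^sub>R x = - (\<Sum>z\<in>Z - {x}. f z *\<^sub>R z)"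
    using sum x \<open>finite Z\<close> by (simp add: sum.remove eq_neg_iff_add_eq_0)
  then have "m (f x *\<^sub>R x) = m (\<Sum>z\<in>Z - {x}. f z *\<^sub>R z)"
    by simp
  also have "\<dots> \<le> (\<Sum>z\<in>Z - {x}. m (f z *\<^sub>R z))"
    by (rule m_sum_le)
  also have "\<dots> = (\<Sum>z\<in>Z - {x}. \<bar>f z\<bar> *\<^sub>R z)"
    using pos by (intro sum.cong) (auto simp: m_scaleR m_of_nonneg)
  finally have le: "\<bar>f x\<bar> *\<^sub>R x \<le> (\<Sum>z\<in>Z - {x}. \<bar>f z\<bar> *\<^sub>R z)"
    using pos x by (simp add: m_scaleR m_of_nonneg)
  have "lat_disj (\<bar>f x\<bar> *\<^sub>R x) (\<Sum>z\<in>Z - {x}. \<bar>f z\<bar> *\<^sub>R z)"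
    using pos x dis by (intro lat_disj_sum lat_disj_scaleR scaleR_nonneg_nonneg) auto
  from lat_disjD[OF this order_refl le] have "\<bar>f x\<bar> *\<^sub>R x \<le> 0" .
  moreover have "0 \<le> \<bar>f x\<bar> *\<^sub>R x"
    using pos x by (intro scaleR_nonneg_nonneg) auto
  ultimately have "\<bar>f x\<bar> *\<^sub>R x = 0"
    by (rule antisym)
  then show "f x = 0"
    using pos x by auto
qed

text \<open>
  Otherwise the bumps \<open>pos_part (e *\<^sub>R (x + y) - m (x - i *\<^sub>R y))\<close>, where \<open>i = 1, 2, \<dots>\<close> and \<open>e\<close> is
  small, would be nonzero and pairwise disjoint, hence linearly independent.
\<close>

lemma exists_difference_dominating_sum:
  assumes B: "finite B" "span B = (UNIV :: 'a set)" and x: "0 \<le> x" and y: "0 \<le> y"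
  obtains t e where "0 < t" "0 < e" "e *\<^sub>R (x + y) \<le> m (x - t *\<^sub>R y)"
proof (rule ccontr)
  assume "\<not> thesis"
  with that have no: "\<not> e *\<^sub>R (x + y) \<le> m (x - t *\<^sub>R y)" if "0 < t" "0 < e" for t e
    using that by blast
  \<comment> \<open>One bump more than the number of independent vectors that a spanning set of size
    \<open>card B\<close> permits.\<close>
  define N where "N = Suc (card B)"
  \<comment> \<open>Both coefficients in \<open>c\<close> below are nonnegative as soon as
    \<open>(2 * i + 3) * e \<le> 1\<close>; this value achieves that for all
    \<open>i \<le> N\<close>.\<close>
  define e :: real where "e = 1 / (2 * N + 3)"
  have e: "0 < e" "e < 1" "(2 * real N + 3) * e = 1"
    by (auto simp: e_def field_simps)
  define z where "z i = pos_part (e *\<^sub>R (x + y) - m (x - real i *\<^sub>R y))" for i :: nat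
  have z0: "0 \<le> z i" for i
    by (simp add: z_def)
  have znz: "z i \<noteq> 0" if "i \<in> {1..N}" for i
    using no[of "real i" e] that e(1) by (auto simp: z_def pos_part_eq_0_iff)
  have dis: "lat_disj (z i) (z j)" if "i \<in> {1..N}" "j \<in> {1..N}" "i < j" for i j
  proof -
    \<comment> \<open>The half-integer slope separates the bumps: bump \<open>i\<close> lives where
      \<open>x\<close> is close to \<open>i *\<^sub>R y\<close>, so \<open>w\<close> is positive
      there, while \<open>w\<close> is negative where bump \<open>j\<close> lives.\<close>
    define w where "w = (i + 1 / 2) *\<^sub>R y - x"
    have "e * i \<le> e * N" "e * j \<le> e * N"
      using that e(1) by auto
    moreover have "real i + 1 \<le> real j"
      using that(3) by linarith
    ultimately have c: "0 \<le> (1 - e) * (i + 1 / 2) - e - i" "0 \<le> j - e - (1 + e) * (i + 1 / 2)"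
      using e(3) by (auto simp: algebra_simps add_divide_distrib)
    have "e *\<^sub>R (x + y) - m (x - real i *\<^sub>R y) \<le> e *\<^sub>R (x + y) - (x - real i *\<^sub>R y)"
      by (intro diff_left_mono m_ge)
    also have "\<dots> \<le> e *\<^sub>R (x + y) - (x - real i *\<^sub>R y) + ((1 - e) * (i + 1 / 2) - e - i) *\<^sub>R y"
      using scaleR_nonneg_nonneg[OF c(1) y] by simp
    also have "\<dots> = (1 - e) *\<^sub>R w"
      by (simp add: w_def algebra_simps)
    finally have zi: "z i \<le> (1 - e) *\<^sub>R pos_part w"
      unfolding z_def using e(2) pos_part_mono by (simp flip: pos_part_scaleR)
    have "e *\<^sub>R (x + y) - m (x - real j *\<^sub>R y) \<le> e *\<^sub>R (x + y) - - (x - real j *\<^sub>R y)"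
      by (intro diff_left_mono m_ge)
    also have "\<dots> \<le> e *\<^sub>R (x + y) - - (x - real j *\<^sub>R y) + (j - e - (1 + e) * (i + 1 / 2)) *\<^sub>R y"
      using scaleR_nonneg_nonneg[OF c(2) y] by simp
    also have "\<dots> = (1 + e) *\<^sub>R (- w)"
      by (simp add: w_def algebra_simps)
    finally have zj: "z j \<le> (1 + e) *\<^sub>R pos_part (- w)"
      unfolding z_def using e(1) pos_part_mono by (simp flip: pos_part_scaleR)
    have "lat_disj ((1 - e) *\<^sub>R pos_part w) ((1 + e) *\<^sub>R pos_part (- w))"
      by (intro lat_disj_scaleR lat_disj_pos_part pos_part_nonneg)
    from lat_disj_mono[OF this zi zj] show ?thesis .
  qed
  then have dis: "lat_disj (z i) (z j)" if "i \<in> {1..N}" "j \<in> {1..N}" "i \<noteq> j" for i j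
    using that lat_disj_commute by (metis linorder_neqE_nat)
  \<comment> \<open>Equal bumps with different indices would be disjoint from themselves, hence
    zero.\<close>
  have "inj_on z {1..N}"
  proof (rule inj_onI, rule ccontr)
    fix i j assume ij: "i \<in> {1..N}" "j \<in> {1..N}" "z i = z j" "i \<noteq> j"
    then have "z i \<le> 0"
      using lat_disjD[OF dis[OF ij(1,2,4)], of "z i"] by simp
    with z0 znz ij show False
      by (metis antisym)
  qed
  then have "card (z ` {1..N}) = N"
    by (simp add: card_image)
  moreover have "independent (z ` {1..N})"
  proof (rule independent_if_disj)
    show "lat_disj v w" if "v \<in> z ` {1..N}" "w \<in> z ` {1..N}" "v \<noteq> w" for v w
    proof -
      obtain i j where "i \<in> {1..N}" "j \<in> {1..N}" "v = z i" "w = z j"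
        using \<open>v \<in> z ` {1..N}\<close> \<open>w \<in> z ` {1..N}\<close> by blast
      with \<open>v \<noteq> w\<close> show ?thesis
        using dis[of i j] by blast
    qed
    show "0 \<le> v \<and> v \<noteq> 0" if "v \<in> z ` {1..N}" for v
      using that z0 znz by (auto simp del: atLeastAtMost_iff)
  qed simp
  then have "card (z ` {1..N}) \<le> card B"
    using independent_span_bound[of B] B by auto
  ultimately show False
    by (simp add: N_def)
qed

section \<open>Ideals and order units\<close>

definition ideal :: "'a set \<Rightarrow> bool" where
  "ideal J \<longleftrightarrow> subspace J \<and> (\<forall>x\<in>J. \<forall>y. m y \<le> m x \<longrightarrow> y \<in> J)"

lemma ideal_subspace: "ideal J \<Longrightarrow> subspace J"
  by (simp add: ideal_def)

lemma ideal_solid: "ideal J \<Longrightarrow> x \<in> J \<Longrightarrow> m y \<le> m x \<Longrightarrow> y \<in> J"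
  by (simp add: ideal_def)

lemma ideal_m: "ideal J \<Longrightarrow> x \<in> J \<Longrightarrow> m x \<in> J"
  unfolding ideal_def using m_of_nonneg[OF m_nonneg] by (metis order_refl)

lemma ideal_pos_part: "ideal J \<Longrightarrow> x \<in> J \<Longrightarrow> pos_part x \<in> J"
  unfolding ideal_def using pos_part_le_m m_of_nonneg[OF pos_part_nonneg] by metis

text \<open>For \<open>0 \<le> u\<close> this is the ideal generated by \<open>u\<close>, and
  \<open>u\<close> is an order unit of it.\<close>

definition pideal :: "'a \<Rightarrow> 'a set" where
  "pideal u = {x. \<exists>c. m x \<le> c *\<^sub>R u}"

lemma ideal_pideal: "ideal (pideal u)"
  unfolding ideal_def
proof (intro conjI ballI allI impI)
  show "subspace (pideal u)"
  proof (rule subspaceI)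
    show "0 \<in> pideal u"
      by (auto simp: pideal_def m_of_nonneg intro: exI[of _ 0])
  next
    fix x y assume "x \<in> pideal u" "y \<in> pideal u"
    then obtain c d where "m x \<le> c *\<^sub>R u" "m y \<le> d *\<^sub>R u"
      by (auto simp: pideal_def)
    then have "m x + m y \<le> (c + d) *\<^sub>R u"
      using add_mono by (simp add: scaleR_add_left)
    with m_triangle[of x y] show "x + y \<in> pideal u"
      unfolding pideal_def using order_trans by blast
  next
    fix k x assume "x \<in> pideal u"
    then obtain c where "m x \<le> c *\<^sub>R u"
      by (auto simp: pideal_def)
    then have "m (k *\<^sub>R x) \<le> (\<bar>k\<bar> * c) *\<^sub>R u"
      using scaleR_left_mono[of "m x" "c *\<^sub>R u" "\<bar>k\<bar>"] by (simp add: m_scaleR)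
    then show "k *\<^sub>R x \<in> pideal u"
      by (auto simp: pideal_def)
  qed
  show "y \<in> pideal u" if "x \<in> pideal u" "m y \<le> m x" for x y
    using that order_trans unfolding pideal_def by blast
qed

lemma generator_in_pideal: "0 \<le> u \<Longrightarrow> u \<in> pideal u"
  by (auto simp: pideal_def m_of_nonneg intro: exI[of _ 1])

lemma pideal_subset:
  assumes "ideal J" "u \<in> J"
  shows "pideal u \<subseteq> J"
proof
  fix x assume "x \<in> pideal u"
  then obtain c where "m x \<le> c *\<^sub>R u"
    by (auto simp: pideal_def)
  also have "\<dots> \<le> m (c *\<^sub>R u)"
    by (rule m_ge)
  finally show "x \<in> J"
    using assms unfolding ideal_def by (meson subspace_scale)
qed

text \<open>In finite dimension the sum of the moduli of a basis of \<open>J\<close> is an order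
  unit of \<open>J\<close>.\<close>

lemma ideal_principal:
  assumes B: "finite B" "span B = (UNIV :: 'a set)" and J: "ideal J"
  obtains u where "0 \<le> u" "J = pideal u"
proof -
  obtain C where C: "C \<subseteq> J" "independent C" "J \<subseteq> span C"
    using maximal_independent_subset by blast
  have fin: "finite C"
    using independent_span_bound[of B C] B C by auto
  define u where "u = sum m C"
  have sub: "subspace J" "subspace (pideal u)"
    using J ideal_pideal by (auto simp: ideal_def)
  have "u \<in> J"
    unfolding u_def using C(1) J by (intro subspace_sum sub ideal_m) auto
  then have "pideal u \<subseteq> J"
    using J by (intro pideal_subset)
  moreover have "C \<subseteq> pideal u"
  proof
    fix c assume "c \<in> C"
    then have "m c \<le> u"
      unfolding u_def using fin by (simp add: sum.remove[of C c] sum_nonneg)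
    then show "c \<in> pideal u"
      by (auto simp: pideal_def intro: exI[of _ 1])
  qed
  then have "J \<subseteq> pideal u"
    using C(3) span_minimal[OF _ sub(2)] by blast
  moreover have "0 \<le> u"
    by (simp add: u_def sum_nonneg)
  ultimately show thesis
    using that by blast
qed

end

section \<open>Forests\<close>

lemma total_on_mono: "total_on A r \<Longrightarrow> r \<subseteq> q \<Longrightarrow> total_on A q"
  by (simp add: total_on_def subset_iff) blast

lemma forest_total_on: "forest S r \<Longrightarrow> s \<in> S \<Longrightarrow> total_on {t \<in> S. (t, s) \<in> r \<and> t \<noteq> s} r"
  by (simp add: forest_def)

text \<open>The relations live on disjoint carriers, so two pairs that share a point come from the
  same relation, and strict down-sets do not change.\<close>

lemma forest_Un:
  assumes "forest S r" "forest S' r'" "S \<inter> S' = {}"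
  shows "forest (S \<union> S') (r \<union> r')"
proof -
  have sub: "r \<subseteq> S \<times> S" "r' \<subseteq> S' \<times> S'" and po: "partial_order_on S r" "partial_order_on S' r'"
    using assms by (auto simp: forest_def partial_order_on_def preorder_on_def)
  have "trans (r \<union> r')"
  proof (rule transI)
    fix x y z assume "(x, y) \<in> r \<union> r'" "(y, z) \<in> r \<union> r'"
    then have "(x, y) \<in> r \<and> (y, z) \<in> r \<or> (x, y) \<in> r' \<and> (y, z) \<in> r'"
      using sub assms(3) by auto
    then show "(x, z) \<in> r \<union> r'"
      using transD[OF partial_order_onD(2)[OF po(1)], of x y z]
        transD[OF partial_order_onD(2)[OF po(2)], of x y z] by auto
  qed
  moreover have "antisym (r \<union> r')"
  proof (rule antisymI)
    fix x y assume "(x, y) \<in> r \<union> r'" "(y, x) \<in> r \<union> r'"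
    then have "(x, y) \<in> r \<and> (y, x) \<in> r \<or> (x, y) \<in> r' \<and> (y, x) \<in> r'"
      using sub assms(3) by auto
    then show "x = y"
      using antisymD[OF partial_order_onD(3)[OF po(1)], of x y]
        antisymD[OF partial_order_onD(3)[OF po(2)], of x y] by auto
  qed
  moreover have "refl_on (S \<union> S') (r \<union> r')"
    using partial_order_onD(1)[OF po(1)] partial_order_onD(1)[OF po(2)] by (auto simp: refl_on_def)
  moreover have "r \<union> r' \<subseteq> (S \<union> S') \<times> (S \<union> S')"
    using sub by auto
  ultimately have "partial_order_on (S \<union> S') (r \<union> r')"
    by (simp add: partial_order_on_def preorder_on_def)
  moreover have "total_on {t \<in> S \<union> S'. (t, s) \<in> r \<union> r' \<and> t \<noteq> s} (r \<union> r')" if "s \<in> S \<union> S'" for s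
  proof (cases "s \<in> S")
    case True
    then have eq: "{t \<in> S \<union> S'. (t, s) \<in> r \<union> r' \<and> t \<noteq> s} = {t \<in> S. (t, s) \<in> r \<and> t \<noteq> s}"
      using sub assms(3) by auto
    show ?thesis
      unfolding eq by (rule total_on_mono[OF forest_total_on[OF assms(1) True]]) simp
  next
    case False
    with that have "s \<in> S'"
      by simp
    then have eq: "{t \<in> S \<union> S'. (t, s) \<in> r \<union> r' \<and> t \<noteq> s} = {t \<in> S'. (t, s) \<in> r' \<and> t \<noteq> s}"
      using sub assms(3) by auto
    show ?thesis
      unfolding eq by (rule total_on_mono[OF forest_total_on[OF assms(2) \<open>s \<in> S'\<close>]]) simp
  qed
  ultimately show ?thesis
    by (simp add: forest_def)
qed

lemma lex_nonneg_Un: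
  assumes "r \<subseteq> S \<times> S" "r' \<subseteq> S' \<times> S'" "S \<inter> S' = {}"
  shows "lex_nonneg (S \<union> S') (r \<union> r') f \<longleftrightarrow> lex_nonneg S r f \<and> lex_nonneg S' r' f"
proof -
  have "(\<exists>t\<in>S \<union> S'. (t, s) \<in> r \<union> r' \<and> t \<noteq> s \<and> 0 < f t) \<longleftrightarrow> (\<exists>t\<in>S. (t, s) \<in> r \<and> t \<noteq> s \<and> 0 < f t)"
    if "s \<in> S" for s
    using that assms by auto
  moreover have "(\<exists>t\<in>S \<union> S'. (t, s) \<in> r \<union> r' \<and> t \<noteq> s \<and> 0 < f t) \<longleftrightarrow> (\<exists>t\<in>S'. (t, s) \<in> r' \<and> t \<noteq> s \<and> 0 < f t)"
    if "s \<in> S'" for s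
    using that assms by auto
  ultimately show ?thesis
    by (simp add: lex_nonneg_def ball_Un)
qed

text \<open>Strict down-sets of old points only gain \<open>u\<close>, which is comparable to
  everything; that of \<open>u\<close> is empty.\<close>

lemma forest_insert_bottom:
  assumes "forest S r" "u \<notin> S"
  shows "forest (insert u S) (r \<union> {u} \<times> insert u S)"
proof -
  have sub: "r \<subseteq> S \<times> S" and po: "partial_order_on S r"
    using assms by (auto simp: forest_def partial_order_on_def preorder_on_def)
  have "trans (r \<union> {u} \<times> insert u S)"
  proof (rule transI)
    fix x y z assume "(x, y) \<in> r \<union> {u} \<times> insert u S" "(y, z) \<in> r \<union> {u} \<times> insert u S"
    then have "(x, y) \<in> r \<and> (y, z) \<in> r \<or> x = u \<and> z \<in> insert u S"
      using sub assms(2) by auto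
    then show "(x, z) \<in> r \<union> {u} \<times> insert u S"
      using transD[OF partial_order_onD(2)[OF po], of x y z] by auto
  qed
  moreover have "antisym (r \<union> {u} \<times> insert u S)"
  proof (rule antisymI)
    fix x y assume "(x, y) \<in> r \<union> {u} \<times> insert u S" "(y, x) \<in> r \<union> {u} \<times> insert u S"
    then have "(x, y) \<in> r \<and> (y, x) \<in> r \<or> x = y"
      using sub assms(2) by auto
    then show "x = y"
      using antisymD[OF partial_order_onD(3)[OF po], of x y] by auto
  qed
  moreover have "refl_on (insert u S) (r \<union> {u} \<times> insert u S)"
    using partial_order_onD(1)[OF po] by (auto simp: refl_on_def)
  moreover have "r \<union> {u} \<times> insert u S \<subseteq> insert u S \<times> insert u S"
    using sub by auto
  ultimately have "partial_order_on (insert u S) (r \<union> {u} \<times> insert u S)"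
    by (simp add: partial_order_on_def preorder_on_def)
  moreover have "total_on {t \<in> insert u S. (t, s) \<in> r \<union> {u} \<times> insert u S \<and> t \<noteq> s} (r \<union> {u} \<times> insert u S)"
    if "s \<in> insert u S" for s
  proof (cases "s = u")
    case True
    then have eq: "{t \<in> insert u S. (t, s) \<in> r \<union> {u} \<times> insert u S \<and> t \<noteq> s} = {}"
      using sub assms(2) by auto
    show ?thesis
      unfolding eq by (simp add: total_on_def)
  next
    case False
    then have eq: "{t \<in> insert u S. (t, s) \<in> r \<union> {u} \<times> insert u S \<and> t \<noteq> s} =
        insert u {t \<in> S. (t, s) \<in> r \<and> t \<noteq> s}"
      using that by auto
    have "total_on {t \<in> S. (t, s) \<in> r \<and> t \<noteq> s} r"
      using assms(1) that False by (simp add: forest_def)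
    then show ?thesis
      unfolding eq total_on_def by auto
  qed
  ultimately show ?thesis
    by (simp add: forest_def)
qed

lemma forest_subset: "forest S r \<Longrightarrow> r \<subseteq> S \<times> S"
  by (simp add: forest_def partial_order_on_def preorder_on_def)

text \<open>A positive value at the root compensates every negative value above it, and a negative
  one cannot be compensated, since nothing lies below the root.\<close>

lemma lex_nonneg_insert_bottom:
  assumes "r \<subseteq> S \<times> S" "u \<notin> S"
  shows "lex_nonneg (insert u S) (r \<union> {u} \<times> insert u S) f \<longleftrightarrow> 0 < f u \<or> f u = 0 \<and> lex_nonneg S r f"
proof -
  have "lex_nonneg (insert u S) (r \<union> {u} \<times> insert u S) f \<longleftrightarrow> \<not> f u < 0 \<and>
      (\<forall>s\<in>S. f s < 0 \<longrightarrow> 0 < f u \<or> (\<exists>t\<in>S. (t, s) \<in> r \<and> t \<noteq> s \<and> 0 < f t))"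
    using assms unfolding lex_nonneg_def by blast
  then show ?thesis
    unfolding lex_nonneg_def by (cases "f u" "0 :: real" rule: linorder_cases) auto
qed

section \<open>Lexicographic bases\<close>

lemma zero_le_add_iff: "0 \<le> a + b \<longleftrightarrow> - b \<le> a" for a b :: "'a::ordered_ab_group_add"
  using diff_le_eq[of 0 b a] by simp

text \<open>The forest points are the basis vectors themselves, so bases are combined by plain
  unions. The last clause implies linear independence: a zero combination makes both
  \<open>f\<close> and \<open>- f\<close> satisfy \<open>lex_nonneg\<close>, which forces
  \<open>f\<close> to vanish on \<open>S\<close>.\<close>

definition lex_basis :: "'a::ordered_real_vector set \<Rightarrow> 'a set \<Rightarrow> 'a rel \<Rightarrow> bool" where
  "lex_basis J S r \<longleftrightarrow> finite S \<and> forest S r \<and> span S = J \<and>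
     (\<forall>f. 0 \<le> (\<Sum>s\<in>S. f s *\<^sub>R s) \<longleftrightarrow> lex_nonneg S r f)"

text \<open>Otherwise the coefficient \<open>- 1\<close> at the zero vector, with \<open>0\<close>
  elsewhere, would give the nonnegative combination \<open>0\<close>, although nothing compensates
  the \<open>- 1\<close>.\<close>

lemma lex_basis_nonzero:
  assumes "lex_basis J S r"
  shows "0 \<notin> S"
proof
  assume "0 \<in> S"
  have nn: "\<And>f. 0 \<le> (\<Sum>s\<in>S. f s *\<^sub>R s) \<longleftrightarrow> lex_nonneg S r f"
    using assms by (auto simp: lex_basis_def)
  have "(\<Sum>s\<in>S. (if s = 0 then - 1 else 0) *\<^sub>R s) = 0"
    by (intro sum.neutral) auto
  then have "lex_nonneg S r (\<lambda>s. if s = 0 then - 1 else 0)"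
    by (subst nn[symmetric]) simp
  with \<open>0 \<in> S\<close> show False
    by (auto simp: lex_nonneg_def split: if_splits)
qed

text \<open>Since \<open>M\<close> is a subspace lying below \<open>u\<close>, all its elements are
  infinitely small against \<open>u\<close>, and the sign of the coefficient of \<open>u\<close>
  decides unless it is zero.\<close>

lemma lex_basis_insert:
  assumes M: "lex_basis M S r" and u: "u \<notin> M" "\<And>y. y \<in> M \<Longrightarrow> y \<le> u"
  shows "lex_basis (span (insert u M)) (insert u S) (r \<union> {u} \<times> insert u S)"
  unfolding lex_basis_def
proof (intro conjI allI)
  have S: "finite S" "forest S r" "span S = M"
    and nn: "\<And>f. 0 \<le> (\<Sum>s\<in>S. f s *\<^sub>R s) \<longleftrightarrow> lex_nonneg S r f"
    using M by (auto simp: lex_basis_def)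
  have "u \<notin> S"
    using u(1) S(3) span_base by blast
  have subM: "subspace M"
    using S(3) subspace_span by blast
  show "finite (insert u S)"
    using S(1) by simp
  show "forest (insert u S) (r \<union> {u} \<times> insert u S)"
    using S(2) \<open>u \<notin> S\<close> by (rule forest_insert_bottom)
  show "span (insert u S) = span (insert u M)"
    by (simp add: set_eq_iff span_breakdown_eq span_span S(3)[symmetric])
  fix f
  define y where "y = (\<Sum>s\<in>S. f s *\<^sub>R s)"
  have y: "y \<in> M"
    unfolding y_def S(3)[symmetric] by (intro span_sum span_scale span_base)
  have "0 \<le> f u *\<^sub>R u + y \<longleftrightarrow> 0 < f u \<or> f u = 0 \<and> 0 \<le> y"
  proof (cases "f u" "0 :: real" rule: linorder_cases)
    case greater
    have "- y /\<^sub>R f u \<le> u"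
      using y by (intro u(2) subspace_scale[OF subM] subspace_neg[OF subM])
    then have "- y \<le> f u *\<^sub>R u"
      using greater by (simp add: pos_divideR_le_eq del: scaleR_minus_right)
    then show ?thesis
      using greater by (simp add: zero_le_add_iff)
  next
    case less
    \<comment> \<open>Nonnegativity would put \<open>u\<close> below an element of \<open>M\<close>;
      as \<open>M\<close> lies below \<open>u\<close>, the two would be equal, contradicting
      \<open>u \<notin> M\<close>.\<close>
    have "\<not> 0 \<le> f u *\<^sub>R u + y"
    proof
      assume "0 \<le> f u *\<^sub>R u + y"
      then have "(- f u) *\<^sub>R u \<le> y"
        by (simp add: zero_le_add_iff[of y] add.commute)
      then have "u \<le> y /\<^sub>R (- f u)"
        using less by (subst pos_le_divideR_eq) auto
      moreover have "y /\<^sub>R (- f u) \<in> M"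
        using y by (rule subspace_scale[OF subM])
      ultimately have "u = y /\<^sub>R (- f u)"
        by (intro antisym u(2))
      with \<open>y /\<^sub>R (- f u) \<in> M\<close> u(1) show False
        by metis
    qed
    with less show ?thesis
      by (metis less_asym less_irrefl)
  next
    case equal
    then show ?thesis
      by simp
  qed
  then show "0 \<le> (\<Sum>s\<in>insert u S. f s *\<^sub>R s) \<longleftrightarrow> lex_nonneg (insert u S) (r \<union> {u} \<times> insert u S) f"
    unfolding lex_nonneg_insert_bottom[OF forest_subset[OF S(2)] \<open>u \<notin> S\<close>]
      sum.insert[OF S(1) \<open>u \<notin> S\<close>] y_def nn .
qed

context modulus
begin

lemma pideal_add:
  assumes a: "0 \<le> a" and b: "0 \<le> b"
  shows "pideal (a + b) = {x + y |x y. x \<in> pideal a \<and> y \<in> pideal b}"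
proof
  have sub: "subspace {x + y |x y. x \<in> pideal a \<and> y \<in> pideal b}"
    by (intro subspace_sums ideal_subspace ideal_pideal)
  have pos: "x \<in> {x + y |x y. x \<in> pideal a \<and> y \<in> pideal b}"
    if "0 \<le> x" "x \<le> c *\<^sub>R (a + b)" "0 \<le> c" for x c
  proof -
    \<comment> \<open>Riesz decomposition: \<open>?y\<close> is the excess of \<open>x\<close> over
      \<open>c *\<^sub>R a\<close>. It is at most \<open>c *\<^sub>R b\<close>, and the rest
      \<open>x - ?y\<close> is at most \<open>c *\<^sub>R a\<close>.\<close>
    let ?y = "pos_part (x - c *\<^sub>R a)"
    have ca: "0 \<le> c *\<^sub>R a" and cb: "0 \<le> c *\<^sub>R b"
      using that(3) a b by (auto intro: scaleR_nonneg_nonneg)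
    have "?y \<le> pos_part (c *\<^sub>R b)"
      using that(2) by (intro pos_part_mono) (simp add: algebra_simps)
    then have yb: "?y \<in> pideal b"
      using cb by (auto simp: pideal_def m_of_nonneg pos_part_of_nonneg)
    have "?y \<le> pos_part x"
      using ca by (intro pos_part_mono) simp
    then have "m (x - ?y) = x - ?y"
      using that(1) by (intro m_of_nonneg) (simp add: pos_part_of_nonneg)
    moreover have "x - ?y \<le> c *\<^sub>R a"
      using pos_part_ge[of "x - c *\<^sub>R a"] by (simp add: algebra_simps)
    ultimately have "m (x - ?y) \<le> c *\<^sub>R a"
      by simp
    then have "x - ?y \<in> pideal a"
      by (auto simp: pideal_def)
    moreover have "x = (x - ?y) + ?y"
      by simp
    ultimately show ?thesis
      using yb by blast
  qed
  show "pideal (a + b) \<subseteq> {x + y |x y. x \<in> pideal a \<and> y \<in> pideal b}"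
  proof
    fix x assume "x \<in> pideal (a + b)"
    then obtain c where "m x \<le> c *\<^sub>R (a + b)"
      by (auto simp: pideal_def)
    \<comment> \<open>The constant in \<open>pideal\<close> may have any sign, while
      \<open>pos\<close> needs a nonnegative one.\<close>
    also have "\<dots> \<le> \<bar>c\<bar> *\<^sub>R (a + b)"
      using a b by (intro scaleR_right_mono) auto
    finally have mx: "m x \<le> \<bar>c\<bar> *\<^sub>R (a + b)" .
    have "pos_part x \<in> {x + y |x y. x \<in> pideal a \<and> y \<in> pideal b}"
      using order_trans[OF pos_part_le_m[of x] mx] by (intro pos[of _ "\<bar>c\<bar>"]) auto
    moreover have "pos_part (- x) \<in> {x + y |x y. x \<in> pideal a \<and> y \<in> pideal b}"
      using order_trans[OF pos_part_le_m[of "- x"]] mx by (intro pos[of _ "\<bar>c\<bar>"]) auto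
    ultimately show "x \<in> {x + y |x y. x \<in> pideal a \<and> y \<in> pideal b}"
      using subspace_diff[OF sub, of "pos_part x" "pos_part (- x)"] unfolding pos_part_minus_neg by blast
  qed
  have ab: "a + b \<in> pideal (a + b)"
    using a b by (intro generator_in_pideal add_nonneg_nonneg)
  have "m a \<le> m (a + b)" "m b \<le> m (a + b)"
    using a b by (simp_all add: m_of_nonneg)
  then have "a \<in> pideal (a + b)" "b \<in> pideal (a + b)"
    using ab ideal_solid[OF ideal_pideal] by blast+
  then have "pideal a \<subseteq> pideal (a + b)" "pideal b \<subseteq> pideal (a + b)"
    using pideal_subset[OF ideal_pideal] by blast+
  then show "{x + y |x y. x \<in> pideal a \<and> y \<in> pideal b} \<subseteq> pideal (a + b)"
    using subspace_add[OF ideal_subspace[OF ideal_pideal]] by blast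
qed

text \<open>From \<open>- x \<le> y\<close> it follows that \<open>- x\<close> lies below multiples
  of both \<open>a\<close> and \<open>b\<close>, hence below \<open>0\<close>; likewise for
  \<open>y\<close>. The order on the sum of the two ideals is therefore componentwise.\<close>

lemma nonneg_add_disj_iff:
  assumes ab: "lat_disj a b" "0 \<le> a" "0 \<le> b" and x: "x \<in> pideal a" and y: "y \<in> pideal b"
  shows "0 \<le> x + y \<longleftrightarrow> 0 \<le> x \<and> 0 \<le> y"
proof
  have *: "0 \<le> x" if dis: "lat_disj a b" "0 \<le> a" "0 \<le> b"
    and mem: "x \<in> pideal a" "y \<in> pideal b" and pos: "0 \<le> x + y" for a b x y
  proof -
    obtain c d where "m x \<le> c *\<^sub>R a" "m y \<le> d *\<^sub>R b"
      using mem by (auto simp: pideal_def)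
    then have "- x \<le> c *\<^sub>R a" "y \<le> d *\<^sub>R b"
      using order_trans[OF m_ge(2)] order_trans[OF m_ge(1)] by auto
    moreover have "- x \<le> y"
      using pos zero_le_add_iff[of y x] by (simp add: add.commute)
    ultimately have "- x \<le> 0"
      by (intro lat_disjD[OF lat_disj_scaleR[OF dis]]) (auto intro: order_trans)
    then show ?thesis
      by simp
  qed
  assume xy: "0 \<le> x + y"
  have "0 \<le> x"
    using *[OF ab x y xy] .
  moreover have "0 \<le> y"
    using *[OF ab(1)[unfolded lat_disj_commute[of a]] ab(3,2) y x] xy by (simp add: add.commute)
  ultimately show "0 \<le> x \<and> 0 \<le> y" ..
qed (auto intro: add_nonneg_nonneg)

lemma lex_basis_disj:
  assumes ab: "lat_disj a b" "0 \<le> a" "0 \<le> b"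
    and S: "lex_basis (pideal a) S r" and S': "lex_basis (pideal b) S' r'"
  shows "lex_basis (pideal (a + b)) (S \<union> S') (r \<union> r')"
  unfolding lex_basis_def
proof (intro conjI allI)
  have span: "span S = pideal a" "span S' = pideal b" and fin: "finite S" "finite S'"
    and f: "forest S r" "forest S' r'"
    and nn: "\<And>f. 0 \<le> (\<Sum>s\<in>S. f s *\<^sub>R s) \<longleftrightarrow> lex_nonneg S r f"
      "\<And>f. 0 \<le> (\<Sum>s\<in>S'. f s *\<^sub>R s) \<longleftrightarrow> lex_nonneg S' r' f"
    using S S' by (simp_all add: lex_basis_def)
  \<comment> \<open>A common vector \<open>s\<close> lies together with \<open>- s\<close> in both
    ideals; splitting \<open>s + (- s) = 0\<close> gives \<open>0 \<le> s\<close> and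
    \<open>0 \<le> - s\<close>, although \<open>0\<close> is not in \<open>S\<close>.\<close>
  have disjoint: "S \<inter> S' = {}"
  proof (rule ccontr)
    assume "S \<inter> S' \<noteq> {}"
    then obtain s where s: "s \<in> S" "s \<in> S'"
      by blast
    then have "s \<in> pideal a" "- s \<in> pideal a" "s \<in> pideal b" "- s \<in> pideal b"
      unfolding span[symmetric] by (auto intro: span_neg span_base)
    then have "0 \<le> s" "0 \<le> - s"
      using nonneg_add_disj_iff[OF ab, of s "- s"] by simp_all
    then have "s = 0"
      by (intro antisym) auto
    with s lex_basis_nonzero[OF S] show False
      by simp
  qed
  show "finite (S \<union> S')"
    using fin by simp
  show "forest (S \<union> S') (r \<union> r')"
    using f disjoint by (rule forest_Un)
  show "span (S \<union> S') = pideal (a + b)"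
    unfolding pideal_add[OF ab(2,3)] span_Un span by auto
  fix f
  have "(\<Sum>s\<in>S. f s *\<^sub>R s) \<in> pideal a" "(\<Sum>s\<in>S'. f s *\<^sub>R s) \<in> pideal b"
    unfolding span[symmetric] by (intro span_sum span_scale span_base; assumption)+
  from nonneg_add_disj_iff[OF ab this]
  show "0 \<le> (\<Sum>s\<in>S \<union> S'. f s *\<^sub>R s) \<longleftrightarrow> lex_nonneg (S \<union> S') (r \<union> r') f"
    unfolding lex_nonneg_Un[OF f[THEN forest_subset] disjoint] sum.union_disjoint[OF fin disjoint] nn .
qed

end

section \<open>Existence of lexicographic bases\<close>

text \<open>This drives the induction on dimension: a basis of \<open>K\<close> extends to one of
  \<open>J\<close>, properly because \<open>J\<close> is not contained in \<open>K\<close>.\<close>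

lemma dim_psubset_subspace:
  fixes B J K :: "'a::real_vector set"
  assumes B: "finite B" "span B = UNIV" and K: "subspace K" "K \<subset> J"
  shows "dim K < dim J"
proof -
  obtain C where C: "C \<subseteq> K" "independent C" "K \<subseteq> span C"
    using maximal_independent_subset by blast
  have "C \<subseteq> J"
    using C(1) K(2) by blast
  then obtain D where D: "C \<subseteq> D" "D \<subseteq> J" "independent D" "J \<subseteq> span D"
    using maximal_independent_subset_extend C(2) by blast
  have "finite D"
    using independent_span_bound[OF B(1) D(3)] B(2) by simp
  have "C \<noteq> D"
    using D(4) K span_minimal[OF C(1) K(1)] by blast
  with D(1) have "card C < card D"
    using psubset_card_mono[OF \<open>finite D\<close>] by blast
  then show ?thesis
    using basis_card_eq_dim[OF C(1,3,2)] basis_card_eq_dim[OF D(2,4,3)] by simp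
qed

lemma scaleR_le_scaleR_same:
  fixes u :: "'a::ordered_real_vector"
  assumes "0 \<le> u" "u \<noteq> 0" "s *\<^sub>R u \<le> t *\<^sub>R u"
  shows "s \<le> t"
proof (rule ccontr)
  assume "\<not> s \<le> t"
  moreover have "(s - t) *\<^sub>R u \<le> (s - t) *\<^sub>R 0"
    using assms(3) by (simp add: scaleR_diff_left)
  ultimately have "u \<le> 0"
    by (subst (asm) scaleR_le_cancel_left_pos) auto
  with assms(1,2) show False
    by (auto dest: antisym)
qed

context modulus
begin

text \<open>The bound \<open>d *\<^sub>R u \<le> a + b\<close> expresses that \<open>a + b\<close>
  is again an order unit of \<open>pideal u\<close>; what is excluded is a splitting into two
  nonzero disjoint ideals.\<close>

definition indecomposable :: "'a \<Rightarrow> bool" where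
  "indecomposable u \<longleftrightarrow> (\<forall>a\<in>pideal u. \<forall>b\<in>pideal u. \<forall>d>0.
     0 \<le> a \<longrightarrow> 0 \<le> b \<longrightarrow> lat_disj a b \<longrightarrow> d *\<^sub>R u \<le> a + b \<longrightarrow> a = 0 \<or> b = 0)"

lemma indecomposableD:
  "indecomposable u \<Longrightarrow> a \<in> pideal u \<Longrightarrow> b \<in> pideal u \<Longrightarrow> 0 < d \<Longrightarrow>
    0 \<le> a \<Longrightarrow> 0 \<le> b \<Longrightarrow> lat_disj a b \<Longrightarrow> d *\<^sub>R u \<le> a + b \<Longrightarrow> a = 0 \<or> b = 0"
  unfolding indecomposable_def by blast

lemma indecomposable_ideal:
  assumes B: "finite B" "span B = (UNIV :: 'a set)" and u: "0 \<le> u" "u \<noteq> 0"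
    and indec: "indecomposable u"
  obtains M where "ideal M" "u \<notin> M" "pideal u = span (insert u M)" "\<And>y. y \<in> M \<Longrightarrow> y \<le> u"
proof -
  define M where "M = {x \<in> pideal u. \<forall>d>0. \<not> d *\<^sub>R u \<le> m x}"
  note sub = ideal_subspace[OF ideal_pideal]
  have up: "u \<in> pideal u"
    using u(1) by (rule generator_in_pideal)
  \<comment> \<open>The parts of \<open>z\<close> are disjoint with sum \<open>m z\<close>, which
    dominates a multiple of \<open>u\<close>. By indecomposability one of them vanishes, so
    \<open>m z\<close> is \<open>z\<close> or \<open>- z\<close>.\<close>
  have sign: "\<exists>d>0. d *\<^sub>R u \<le> z \<or> d *\<^sub>R u \<le> - z" if z: "z \<in> pideal u" "z \<notin> M" for z
  proof -
    obtain d where d: "0 < d" "d *\<^sub>R u \<le> m z"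
      using z by (auto simp: M_def)
    have "pos_part z = 0 \<or> pos_part (- z) = 0"
      using d z(1) subspace_neg[OF sub z(1)]
      by (intro indecomposableD[OF indec, of _ _ d] lat_disj_pos_part pos_part_nonneg
          ideal_pos_part[OF ideal_pideal])
        (simp_all add: pos_part_plus_neg)
    then have "m z = z \<or> m z = - z"
      using m_of_nonneg[of z] m_of_nonneg[of "- z"] by (auto simp: pos_part_eq_0_iff)
    with d show ?thesis
      by auto
  qed
  have subM: "subspace M"
  proof (rule subspaceI)
    have "\<not> d *\<^sub>R u \<le> 0" if "0 < d" for d
      using scaleR_le_scaleR_same[OF u, of d 0] that by auto
    then show "0 \<in> M"
      by (auto simp: M_def m_of_nonneg subspace_0[OF sub])
  next
    fix x y assume x: "x \<in> M" and y: "y \<in> M"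
    then have xp: "x \<in> pideal u" and yp: "y \<in> pideal u"
      by (auto simp: M_def)
    have "\<not> d *\<^sub>R u \<le> m (x + y)" if d: "0 < d" for d
    proof
      assume "d *\<^sub>R u \<le> m (x + y)"
      then have du: "d *\<^sub>R u \<le> m x + m y"
        using m_triangle order_trans by blast
      \<comment> \<open>Indecomposability applies to the parts of \<open>w\<close>, whose sum
        dominates a multiple of \<open>u\<close> by the choice of \<open>t\<close> and
        \<open>e\<close>. The part that survives lies below \<open>m x\<close> or
        \<open>t *\<^sub>R m y\<close>, so \<open>x\<close> or \<open>y\<close> would not be in
        \<open>M\<close>.\<close>
      obtain t e where te: "0 < t" "0 < e" "e *\<^sub>R (m x + m y) \<le> m (m x - t *\<^sub>R m y)"
        using exists_difference_dominating_sum[OF B m_nonneg m_nonneg] by blast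
      define w where "w = m x - t *\<^sub>R m y"
      have w: "w \<in> pideal u"
        unfolding w_def using xp yp
        by (intro subspace_diff[OF sub] subspace_scale[OF sub] ideal_m[OF ideal_pideal])
      have "(e * d) *\<^sub>R u \<le> e *\<^sub>R (m x + m y)"
        using scaleR_left_mono[OF du, of e] te(2) by simp
      with te(3) have le: "(e * d) *\<^sub>R u \<le> pos_part w + pos_part (- w)"
        unfolding pos_part_plus_neg w_def by (rule order_trans[rotated])
      have "pos_part w = 0 \<or> pos_part (- w) = 0"
        using le d te(2) w subspace_neg[OF sub w]
        by (intro indecomposableD[OF indec, of _ _ "e * d"] lat_disj_pos_part pos_part_nonneg
            ideal_pos_part[OF ideal_pideal]) simp_all
      moreover have "0 \<le> t *\<^sub>R m y"
        using te(1) by (intro scaleR_nonneg_nonneg) auto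
      then have "pos_part w \<le> m x" "pos_part (- w) \<le> t *\<^sub>R m y"
        by (auto simp: w_def intro!: pos_part_least)
      ultimately have "(e * d) *\<^sub>R u \<le> m x \<or> (e * d) *\<^sub>R u \<le> t *\<^sub>R m y"
        using le order_trans by fastforce
      then have "(e * d) *\<^sub>R u \<le> m x \<or> (e * d / t) *\<^sub>R u \<le> m y"
        using te(1) pos_divideR_le_eq[of t "(e * d) *\<^sub>R u" "m y"] by (simp add: divide_inverse mult.commute)
      moreover have "0 < e * d" "0 < e * d / t"
        using te d by auto
      ultimately show False
        using x y by (auto simp: M_def)
    qed
    then show "x + y \<in> M"
      using subspace_add[OF sub xp yp] by (simp add: M_def)
  next
    fix c x assume x: "x \<in> M"
    show "c *\<^sub>R x \<in> M"
    proof (cases "c = 0")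
      case True
      have "\<not> d *\<^sub>R u \<le> 0" if "0 < d" for d
        using scaleR_le_scaleR_same[OF u, of d 0] that by auto
      with True show ?thesis
        by (auto simp: M_def m_of_nonneg subspace_0[OF sub])
    next
      case False
      have "\<not> d *\<^sub>R u \<le> m (c *\<^sub>R x)" if d: "0 < d" for d
      proof
        assume "d *\<^sub>R u \<le> m (c *\<^sub>R x)"
        then have "(d / \<bar>c\<bar>) *\<^sub>R u \<le> m x"
          using False pos_divideR_le_eq[of "\<bar>c\<bar>" "d *\<^sub>R u" "m x"]
          by (simp add: m_scaleR divide_inverse mult.commute)
        with x d False show False
          by (simp add: M_def)
      qed
      then show ?thesis
        using x subspace_scale[OF sub] by (simp add: M_def)
    qed
  qed
  have idM: "ideal M"
    unfolding ideal_def
  proof (intro conjI ballI allI impI)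
    fix x y assume "x \<in> M" "m y \<le> m x"
    then show "y \<in> M"
      using ideal_solid[OF ideal_pideal, of x u y] order_trans by (auto simp: M_def)
  qed (rule subM)
  have uM: "u \<notin> M"
    using u(1) by (auto simp: M_def m_of_nonneg intro!: exI[of _ 1])
  have leu: "y \<le> u" if y: "y \<in> M" for y
  proof -
    have "y \<in> pideal u"
      using y by (simp add: M_def)
    \<comment> \<open>By \<open>sign\<close>, \<open>u - y\<close> is then nonnegative or
      nonpositive; the latter would give \<open>u \<le> m y\<close>, which is impossible for
      \<open>y\<close> in \<open>M\<close>.\<close>
    have "u - y \<notin> M"
      using subspace_add[OF subM _ y, of "u - y"] uM by auto
    with sign[of "u - y"] subspace_diff[OF sub up \<open>y \<in> pideal u\<close>]
    obtain d where d: "0 < d" "d *\<^sub>R u \<le> u - y \<or> d *\<^sub>R u \<le> y - u"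
      by auto
    have "0 \<le> d *\<^sub>R u"
      using d(1) u(1) by (intro scaleR_nonneg_nonneg) auto
    have "\<not> d *\<^sub>R u \<le> y - u"
    proof
      assume "d *\<^sub>R u \<le> y - u"
      with \<open>0 \<le> d *\<^sub>R u\<close> have "0 \<le> y - u"
        by (rule order_trans)
      then have "1 *\<^sub>R u \<le> m y"
        using m_ge(1)[of y] by (simp add: order_trans)
      with y show False
        unfolding M_def using zero_less_one by blast
    qed
    with d(2) \<open>0 \<le> d *\<^sub>R u\<close> have "0 \<le> u - y"
      using order_trans by blast
    then show ?thesis
      by simp
  qed
  have "\<exists>t. x - t *\<^sub>R u \<in> M" if x: "x \<in> pideal u" for x
  proof -
    obtain c where c: "m x \<le> c *\<^sub>R u"
      using x by (auto simp: pideal_def)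
    then have cx: "x \<le> c *\<^sub>R u" "- x \<le> c *\<^sub>R u"
      by (simp_all add: m_le_iff)
    \<comment> \<open>The coefficient of \<open>u\<close> is the supremum of \<open>A\<close>. If
      the remainder were outside \<open>M\<close>, then by \<open>sign\<close> it would dominate
      \<open>d *\<^sub>R u\<close> or lie below its negative, and the supremum could be raised or
      lowered by \<open>d\<close>.\<close>
    define A where "A = {t. t *\<^sub>R u \<le> x}"
    have bdd: "t \<le> c" if "t \<in> A" for t
      using that cx(1) by (intro scaleR_le_scaleR_same[OF u]) (auto simp: A_def intro: order_trans)
    then have bA: "bdd_above A"
      by (rule bdd_aboveI)
    have "- c \<in> A"
      using cx(2) by (simp add: A_def minus_le_iff)
    then have neA: "A \<noteq> {}"
      by blast
    define s where "s = Sup A"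
    have "x - s *\<^sub>R u \<in> M"
    proof (rule ccontr)
      assume "x - s *\<^sub>R u \<notin> M"
      with sign[of "x - s *\<^sub>R u"] subspace_diff[OF sub x subspace_scale[OF sub up]]
      obtain d where d: "0 < d" "d *\<^sub>R u \<le> x - s *\<^sub>R u \<or> d *\<^sub>R u \<le> - (x - s *\<^sub>R u)"
        by blast
      from d(2) show False
      proof
        assume "d *\<^sub>R u \<le> x - s *\<^sub>R u"
        then have "s + d \<in> A"
          by (simp add: A_def algebra_simps)
        then have "s + d \<le> s"
          unfolding s_def by (rule cSup_upper[OF _ bA])
        with d(1) show False
          by simp
      next
        assume "d *\<^sub>R u \<le> - (x - s *\<^sub>R u)"
        then have xs: "x \<le> (s - d) *\<^sub>R u"
          by (simp add: algebra_simps)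
        have "t \<le> s - d" if "t \<in> A" for t
          using that xs by (intro scaleR_le_scaleR_same[OF u]) (auto simp: A_def intro: order_trans)
        then have "s \<le> s - d"
          unfolding s_def by (intro cSup_least neA)
        with d(1) show False
          by simp
      qed
    qed
    then show ?thesis ..
  qed
  then have "pideal u \<subseteq> span (insert u M)"
    by (meson span_base span_breakdown_eq subsetI)
  moreover have "span (insert u M) \<subseteq> pideal u"
    using up by (intro span_minimal sub) (auto simp: M_def)
  ultimately show thesis
    using that[OF idM uM _ leu] by blast
qed

text \<open>Strong induction on the dimension. The order unit \<open>u\<close> is zero, or
  \<open>J\<close> splits into two proper ideals, or \<open>u\<close> is indecomposable and the
  proper ideal \<open>M\<close> of \<open>indecomposable_ideal\<close> takes over.\<close>

lemma ideal_lex_basis: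
  assumes B: "finite B" "span B = (UNIV :: 'a set)" and J: "ideal J"
  shows "\<exists>S r. lex_basis J S r"
  using J
proof (induction "dim J" arbitrary: J rule: less_induct)
  case less
  have IH: "\<exists>S r. lex_basis K S r" if "ideal K" "K \<subset> J" for K
    using that by (intro less.hyps dim_psubset_subspace[OF B] ideal_subspace)
  obtain u where u: "0 \<le> u" "J = pideal u"
    using ideal_principal[OF B less.prems] by blast
  consider "u = 0"
    | a b d where "0 \<le> a" "0 \<le> b" "lat_disj a b" "a \<in> J" "b \<in> J" "0 < d" "d *\<^sub>R u \<le> a + b" "a \<noteq> 0" "b \<noteq> 0"
    | "u \<noteq> 0" "indecomposable u"
    unfolding u(2) indecomposable_def by blast
  then show ?case
  proof cases
    case 1
    have "x = 0" if "x \<in> J" for x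
      using that by (auto simp: u(2) 1 pideal_def m_le_iff intro: antisym)
    then have "J = {0}"
      using subspace_0[OF ideal_subspace[OF less.prems]] by blast
    then have "lex_basis J {} {}"
      by (auto simp: lex_basis_def forest_def lex_nonneg_def partial_order_on_def preorder_on_def
          refl_on_def trans_def antisym_def)
    then show ?thesis
      by blast
  next
    case 2
    have sub: "pideal a \<subset> J" if ab: "0 \<le> a" "0 \<le> b" "lat_disj a b" "a \<in> J" "b \<in> J" "b \<noteq> 0" for a b
    proof -
      \<comment> \<open>Otherwise \<open>b\<close> would lie below a multiple of \<open>a\<close>,
        from which it is disjoint, so \<open>b\<close> would be zero.\<close>
      have "b \<notin> pideal a"
      proof
        assume "b \<in> pideal a"
        then obtain c where "m b \<le> c *\<^sub>R a"
          by (auto simp: pideal_def)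
        then have "b \<le> c *\<^sub>R a" "b \<le> 1 *\<^sub>R b"
          by (auto simp: m_le_iff)
        then have "b \<le> 0"
          by (rule lat_disjD[OF lat_disj_scaleR[OF ab(3,1,2)]])
        with ab show False
          by (auto dest: antisym)
      qed
      with ab pideal_subset[OF less.prems] show ?thesis
        by blast
    qed
    have "pideal a \<subset> J" "pideal b \<subset> J"
      using sub[of a b] sub[of b a] 2 by (auto simp: lat_disj_commute)
    then obtain S r S' r' where S: "lex_basis (pideal a) S r" "lex_basis (pideal b) S' r'"
      using IH ideal_pideal by meson
    have "u \<le> (a + b) /\<^sub>R d"
      using 2 by (simp add: pos_le_divideR_eq)
    then have "u \<in> pideal (a + b)"
      using u(1) by (auto simp: pideal_def m_of_nonneg)
    moreover have "a + b \<in> J"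
      using 2 by (intro subspace_add ideal_subspace less.prems)
    ultimately have "J = pideal (a + b)"
      using pideal_subset[OF less.prems] pideal_subset[OF ideal_pideal] u(2) by blast
    with lex_basis_disj[OF \<open>lat_disj a b\<close> \<open>0 \<le> a\<close> \<open>0 \<le> b\<close> S] show ?thesis
      by blast
  next
    case 3
    obtain M where M: "ideal M" "u \<notin> M" "pideal u = span (insert u M)" "\<And>y. y \<in> M \<Longrightarrow> y \<le> u"
      using indecomposable_ideal[OF B u(1) 3] by blast
    have "insert u M \<subseteq> J"
      unfolding u(2) M(3) by (rule span_superset)
    with M(2) obtain S r where "lex_basis M S r"
      using IH[OF M(1)] by blast
    from lex_basis_insert[OF this M(2,4)] show ?thesis
      unfolding u(2) M(3) by blast
  qed
qed

end

section \<open>From lexicographic bases to \<open>Lex(S)\<close>\<close>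

lemma modulus_exists:
  assumes "vector_lattice TYPE('a::ordered_real_vector)"
  obtains m :: "'a::ordered_real_vector \<Rightarrow> 'a" where "modulus m"
proof -
  have "\<forall>x :: 'a. \<exists>z. isLub UNIV {x, - x} z"
    using assms by (simp add: vector_lattice_def)
  then obtain m :: "'a \<Rightarrow> 'a" where "\<And>x. isLub UNIV {x, - x} (m x)"
    by metis
  then have m: "x \<le> m x" "- x \<le> m x" "x \<le> w \<Longrightarrow> - x \<le> w \<Longrightarrow> m x \<le> w" for x w
    by (simp_all add: isLub_pair_iff)
  have "modulus m"
    by unfold_locales (use m(3) order_trans[OF m(1)] order_trans[OF m(2)] in blast)
  then show thesis
    by (rule that)
qed

text \<open>The isomorphism is obtained as the inverse of a linear map out of \<open>F0 S\<close>.
  Injectivity comes from the order: the difference of two vectors with equal images lies in the cone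
  together with its negative, and the cone is pointed.\<close>

lemma isomorphic_LexI:
  fixes L :: "('s \<Rightarrow>\<^sub>0 real) \<Rightarrow> 'a::ordered_real_vector"
  assumes "partial_order_on S r" "linear L" "L ` F0 S = UNIV"
    and pos: "\<And>f. f \<in> F0 S \<Longrightarrow> 0 \<le> L f \<longleftrightarrow> f \<in> Lex_cone S r"
  shows "isomorphic_Lex TYPE('a) S r"
proof -
  have "inj_on L (F0 S)"
  proof (rule inj_onI)
    fix f g assume fg: "f \<in> F0 S" "g \<in> F0 S" "L f = L g"
    have "L (f - g) = 0" "L (- (f - g)) = 0"
      using fg(3) assms(2) by (simp_all add: linear_diff)
    moreover have "f - g \<in> F0 S"
      using fg(1,2) by (rule subspace_diff[OF subspace_F0])
    moreover from this have "- (f - g) \<in> F0 S"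
      by (rule subspace_neg[OF subspace_F0])
    ultimately have "f - g \<in> Lex_cone S r" "- (f - g) \<in> Lex_cone S r"
      by (simp_all flip: pos)
    from Lex_cone_pointed[OF assms(1) this] show "f = g"
      by simp
  qed
  define T where "T = the_inv_into (F0 S) L"
  have TL: "T (L f) = f" if "f \<in> F0 S" for f
    unfolding T_def using \<open>inj_on L (F0 S)\<close> that by (rule the_inv_into_f_f)
  have surj: "\<exists>f\<in>F0 S. x = L f" for x
    using assms(3) by (metis UNIV_I imageE)
  have "linear T"
  proof (rule linearI)
    fix x y
    obtain f g where fg: "f \<in> F0 S" "x = L f" "g \<in> F0 S" "y = L g"
      using surj by metis
    show "T (x + y) = T x + T y"
      using TL[OF subspace_add[OF subspace_F0 fg(1,3)]] fg by (simp add: TL linear_add[OF assms(2)])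
  next
    fix c x
    obtain f where f: "f \<in> F0 S" "x = L f"
      using surj by blast
    show "T (c *\<^sub>R x) = c *\<^sub>R T x"
      using TL[OF subspace_scale[OF subspace_F0 f(1), of c]] f by (simp add: TL linear_scale[OF assms(2)])
  qed
  moreover have "bij_betw T UNIV (F0 S)"
    unfolding T_def using \<open>inj_on L (F0 S)\<close> assms(3)
    by (intro bij_betw_the_inv_into) (simp add: bij_betw_def)
  moreover have "T ` {x. 0 \<le> x} = Lex_cone S r"
  proof (intro equalityI subsetI)
    fix f assume "f \<in> T ` {x. 0 \<le> x}"
    then obtain x where x: "0 \<le> x" "f = T x"
      by blast
    obtain g where g: "g \<in> F0 S" "x = L g"
      using surj by blast
    with x show "f \<in> Lex_cone S r"
      by (simp add: TL flip: pos)
  next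
    fix f assume f: "f \<in> Lex_cone S r"
    then have "f \<in> F0 S"
      by (simp add: Lex_cone_iff)
    with f have "0 \<le> L f" "f = T (L f)"
      by (simp_all add: pos TL)
    then show "f \<in> T ` {x. 0 \<le> x}"
      by blast
  qed
  ultimately show ?thesis
    by (auto simp: isomorphic_Lex_def ordered_iso_def)
qed

text \<open>Transport of structure, used to move a forest of basis vectors to a set of natural
  numbers.\<close>

lemma forest_map_prod:
  assumes S: "forest S r" and h: "inj_on h S"
  shows "forest (h ` S) (map_prod h h ` r)"
proof -
  have sub: "r \<subseteq> S \<times> S" and po: "partial_order_on S r"
    using S by (auto simp: forest_def partial_order_on_def preorder_on_def)
  have mem: "(h x, h y) \<in> map_prod h h ` r \<longleftrightarrow> (x, y) \<in> r" if "x \<in> S" "y \<in> S" for x y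
  proof
    assume "(h x, h y) \<in> map_prod h h ` r"
    then obtain x' y' where "(x', y') \<in> r" "h x = h x'" "h y = h y'"
      by auto
    moreover from this have "x' \<in> S" "y' \<in> S"
      using sub by auto
    ultimately show "(x, y) \<in> r"
      using that by (simp add: inj_on_eq_iff[OF h])
  qed (rule map_prod_imageI)
  have sub': "map_prod h h ` r \<subseteq> h ` S \<times> h ` S"
    using sub by auto
  have "refl_on (h ` S) (map_prod h h ` r)"
    using partial_order_onD(1)[OF po] by (auto simp: refl_on_def mem)
  moreover have "trans (map_prod h h ` r)"
  proof (rule transI)
    fix a b c assume ab: "(a, b) \<in> map_prod h h ` r" and bc: "(b, c) \<in> map_prod h h ` r"
    then have "a \<in> h ` S" "b \<in> h ` S" "c \<in> h ` S"
      using sub' by auto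
    then obtain x y z where "x \<in> S" "y \<in> S" "z \<in> S" "a = h x" "b = h y" "c = h z"
      by blast
    with ab bc show "(a, c) \<in> map_prod h h ` r"
      using transD[OF partial_order_onD(2)[OF po], of x y z] by (simp add: mem)
  qed
  moreover have "antisym (map_prod h h ` r)"
  proof (rule antisymI)
    fix a b assume ab: "(a, b) \<in> map_prod h h ` r" and ba: "(b, a) \<in> map_prod h h ` r"
    then have "a \<in> h ` S" "b \<in> h ` S"
      using sub' by auto
    then obtain x y where "x \<in> S" "y \<in> S" "a = h x" "b = h y"
      by blast
    with ab ba show "a = b"
      using antisymD[OF partial_order_onD(3)[OF po], of x y] by (simp add: mem)
  qed
  moreover have "total_on {t \<in> h ` S. (t, s) \<in> map_prod h h ` r \<and> t \<noteq> s} (map_prod h h ` r)"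
    if s: "s \<in> h ` S" for s
  proof (rule total_onI)
    fix a b assume a: "a \<in> {t \<in> h ` S. (t, s) \<in> map_prod h h ` r \<and> t \<noteq> s}"
      and b: "b \<in> {t \<in> h ` S. (t, s) \<in> map_prod h h ` r \<and> t \<noteq> s}" and ne: "a \<noteq> b"
    obtain x y z where xyz: "x \<in> S" "y \<in> S" "z \<in> S" "a = h x" "b = h y" "s = h z"
      using a b s by blast
    with a b ne have "x \<in> {t \<in> S. (t, z) \<in> r \<and> t \<noteq> z}" "y \<in> {t \<in> S. (t, z) \<in> r \<and> t \<noteq> z}" "x \<noteq> y"
      by (auto simp: mem)
    then have "(x, y) \<in> r \<or> (y, x) \<in> r"
      by (rule forest_total_on[OF S xyz(3), unfolded total_on_def, rule_format])
    with xyz show "(a, b) \<in> map_prod h h ` r \<or> (b, a) \<in> map_prod h h ` r"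
      by (simp add: mem)
  qed
  ultimately show ?thesis
    using sub' by (simp add: forest_def partial_order_on_def preorder_on_def)
qed

lemma lex_nonneg_map_prod:
  assumes r: "r \<subseteq> S \<times> S" and h: "inj_on h S"
  shows "lex_nonneg (h ` S) (map_prod h h ` r) f \<longleftrightarrow> lex_nonneg S r (f \<circ> h)"
proof -
  have mem: "(h x, h y) \<in> map_prod h h ` r \<and> h x \<noteq> h y \<longleftrightarrow> (x, y) \<in> r \<and> x \<noteq> y" if "x \<in> S" "y \<in> S" for x y
  proof
    assume *: "(h x, h y) \<in> map_prod h h ` r \<and> h x \<noteq> h y"
    then obtain x' y' where "(x', y') \<in> r" "h x = h x'" "h y = h y'"
      by auto
    moreover from this have "x' \<in> S" "y' \<in> S"
      using r by auto
    ultimately show "(x, y) \<in> r \<and> x \<noteq> y"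
      using that * by (auto simp: inj_on_eq_iff[OF h])
  next
    assume "(x, y) \<in> r \<and> x \<noteq> y"
    then show "(h x, h y) \<in> map_prod h h ` r \<and> h x \<noteq> h y"
      using that by (auto simp: inj_on_eq_iff[OF h] intro: map_prod_imageI)
  qed
  have "(\<exists>t\<in>h ` S. (t, h s) \<in> map_prod h h ` r \<and> t \<noteq> h s \<and> 0 < f t) \<longleftrightarrow>
      (\<exists>t\<in>S. (t, s) \<in> r \<and> t \<noteq> s \<and> 0 < f (h t))" if "s \<in> S" for s
    using mem that by (simp flip: conj_assoc cong: bex_cong)
  then show ?thesis
    by (simp add: lex_nonneg_def)
qed

lemma lex_basis_isomorphic_Lex:
  fixes S :: "'a::ordered_real_vector set"
  assumes "lex_basis UNIV S r"
  shows "\<exists>(S' :: nat set) r'. finite S' \<and> forest S' r' \<and> isomorphic_Lex TYPE('a) S' r'"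
proof -
  have fin: "finite S" and S: "forest S r" and span: "span S = UNIV"
    and nn: "\<And>f. 0 \<le> (\<Sum>s\<in>S. f s *\<^sub>R s) \<longleftrightarrow> lex_nonneg S r f"
    using assms by (simp_all add: lex_basis_def)
  obtain h :: "'a \<Rightarrow> nat" where h: "inj_on h S"
    using finite_imp_inj_to_nat_seg[OF fin] by blast
  define S' where "S' = h ` S"
  define r' where "r' = map_prod h h ` r"
  have S': "forest S' r'"
    unfolding S'_def r'_def using S h by (rule forest_map_prod)
  \<comment> \<open>The coefficient at the label \<open>h s\<close> belongs to the vector
    \<open>s\<close>; \<open>L\<close> is the inverse of the desired isomorphism.\<close>
  define L where "L f = (\<Sum>s\<in>S. Poly_Mapping.lookup f (h s) *\<^sub>R s)" for f
  have "isomorphic_Lex TYPE('a) S' r'"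
  proof (rule isomorphic_LexI)
    show "partial_order_on S' r'"
      using S' by (simp add: forest_def)
    show "linear L"
    proof (rule linearI)
      show "L (f + g) = L f + L g" for f g
        by (simp add: L_def lookup_add scaleR_add_left sum.distrib)
      show "L (c *\<^sub>R f) = c *\<^sub>R L f" for c f
        by (simp add: L_def lookup_scaleR scaleR_sum_right)
    qed
    have "x \<in> L ` F0 S'" for x
    proof -
      have "x \<in> range (\<lambda>c. \<Sum>s\<in>S. c s *\<^sub>R s)"
        unfolding span_finite[OF fin, symmetric] span by (rule UNIV_I)
      then obtain c where c: "x = (\<Sum>s\<in>S. c s *\<^sub>R s)"
        by (rule rangeE)
      define f where "f = Poly_Mapping.Abs_poly_mapping (\<lambda>n. if n \<in> S' then c (the_inv_into S h n) else 0)"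
      have "finite {n. (if n \<in> S' then c (the_inv_into S h n) else 0) \<noteq> 0}"
        by (rule finite_subset[of _ S']) (auto simp: S'_def fin)
      then have f: "Poly_Mapping.lookup f n = (if n \<in> S' then c (the_inv_into S h n) else 0)" for n
        by (simp add: f_def)
      then have "f \<in> F0 S'"
        by (simp add: F0_def in_keys_iff subset_iff)
      moreover have "x = L f"
        unfolding c L_def by (rule sum.cong) (simp_all add: f S'_def the_inv_into_f_f[OF h])
      ultimately show ?thesis
        by blast
    qed
    then show "L ` F0 S' = UNIV"
      by blast
    fix f assume f: "f \<in> F0 S'"
    have "0 \<le> L f \<longleftrightarrow> lex_nonneg S r (Poly_Mapping.lookup f \<circ> h)"
      using nn[of "Poly_Mapping.lookup f \<circ> h"] unfolding L_def comp_def .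
    also have "\<dots> \<longleftrightarrow> lex_nonneg S' r' (Poly_Mapping.lookup f)"
      unfolding S'_def r'_def by (rule lex_nonneg_map_prod[OF forest_subset[OF S] h, symmetric])
    finally show "0 \<le> L f \<longleftrightarrow> f \<in> Lex_cone S' r'"
      using f by (simp add: Lex_cone_iff)
  qed
  moreover have "finite S'"
    using fin by (simp add: S'_def)
  ultimately show ?thesis
    using S' by blast
qed

text \<open>Finite forests can be relabelled by natural numbers, so carriers in \<open>nat\<close>
  suffice in the equivalence. The second conjunct gives the converse direction for forests in an
  arbitrary type.\<close>

theorem theorem3p5:
  shows "(finite_dimensional TYPE('a::ordered_real_vector) \<and> vector_lattice TYPE('a) \<longleftrightarrow>
            (\<exists>(S :: nat set) r. finite S \<and> forest S r \<and> isomorphic_Lex TYPE('a) S r)) \<and>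
         ((\<exists>(S :: 's set) r. finite S \<and> forest S r \<and> isomorphic_Lex TYPE('a) S r) \<longrightarrow>
            finite_dimensional TYPE('a) \<and> vector_lattice TYPE('a))"
proof (intro conjI iffI impI)
  assume *: "finite_dimensional TYPE('a) \<and> vector_lattice TYPE('a)"
  then obtain m :: "'a \<Rightarrow> 'a" where "modulus m"
    using modulus_exists by blast
  then interpret modulus m .
  obtain B :: "'a set" where B: "finite B" "span B = UNIV"
    using * by (auto simp: finite_dimensional_iff_finite_span)
  have "ideal UNIV"
    by (simp add: ideal_def)
  then obtain S r where "lex_basis (UNIV :: 'a set) S r"
    using ideal_lex_basis[OF B] by blast
  then show "\<exists>(S :: nat set) r. finite S \<and> forest S r \<and> isomorphic_Lex TYPE('a) S r"
    by (intro lex_basis_isomorphic_Lex)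
qed (auto intro: isomorphic_Lex_finite_dimensional isomorphic_Lex_vector_lattice)

end
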